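(* Let $\preceq$ be a partial order on a finite index set $\mathcal{I}$ with $n$ elements (identified with $\{1,\dots,n\}$ as labels), let $G=(V,E)$ be a directed graph corresponding to $\preceq$, and let $D$ be its oriented incidence matrix. Let $\bm{Y}=\mathring{\bm{\beta}}+\bm{\varepsilon}$, where $\mathring{\bm{\beta}}\in\mathbb{R}^n$ is a fixed (unknown) signal and $\bm{\varepsilon}\sim\mathcal{N}(\bm{0},\sigma^2\bm{I})$ with $0<\sigma<\infty$. Fix $\lambda_F,\lambda_L,\lambda_{NI}\ge0$. For $\bm{y}\in\mathbb{R}^n$ let $$K^{FNI}(\bm{y},\lambda_F,\lambda_{NI})=\#\{\text{fused groups in }\hat{\bm{\beta}}^{FNI}(\bm{y},\lambda_F,\lambda_{NI})\},$$ $$K^{FLNI}(\bm{y},\lambda_F,\lambda_L,\lambda_{NI})=\#\{\text{non-zero fused groups in }\hat{\bm{\beta}}^{FLNI}(\bm{y},\lambda_F,\lambda_L,\lambda_{NI})\}.$$ Then $$\mathbb{E}[K^{FNI}(\bm{Y},\lambda_F,\lambda_{NI})]=df(\hat{\bm{\beta}}^{FNI}(\bm{Y},\lambda_F,\lambda_{NI}))$$ and $$\mathbb{E}[K^{FLNI}(\bm{Y},\lambda_F,\lambda_L,\lambda_{NI})]=df(\hat{\bm{\beta}}^{FLNI}(\bm{Y},\lambda_F,\lambda_L,\lambda_{NI})).$$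
   Context: A vector $\bm{\beta}\in\mathbb{R}^n$ indexed by $\mathcal{I}$ is isotonic with respect to $\preceq$ if $\bm{j}_1\preceq\bm{j}_2$ implies $\beta_{\bm{j}_1}\le\beta_{\bm{j}_2}$. A directed graph $G=(V,E)$ corresponds to $\preceq$ if $V=\mathcal{I}$, $E$ is a set of ordered pairs of distinct elements of $\mathcal{I}$, and a vector $\bm{\beta}\in\mathbb{R}^n$ is isotonic with respect to $\preceq$ if and only if $\beta_{\bm{j}_1}\le\beta_{\bm{j}_2}$ for every $(\bm{j}_1,\bm{j}_2)\in E$. The oriented incidence matrix $D$ has one row per edge and one column per vertex, with entry $1$ if the vertex is the source of the edge, $-1$ if it is the target, and $0$ otherwise. Notation: $x_+=x\cdot 1\{x>0\}$; $\|\bm{z}\|_+=\sum_i(z_i)_+$; $\|\bm{z}\|_1=\sum_i|z_i|$. The fused lasso nearly-isotonic approximator is the (unique) minimizer $$\hat{\bm{\beta}}^{FLNI}(\bm{y},\lambda_F,\lambda_L,\lambda_{NI})=\underset{\bm{\beta}\in\mathbb{R}^n}{\arg\min}\ \tfrac12\|\bm{y}-\bm{\beta}\|_2^2+\lambda_F\|D\bm{\beta}\|_1+\lambda_L\|\bm{\beta}\|_1+\lambda_{NI}\|D\bm{\beta}\|_+,$$ and the fused nearly-isotonic regression is $\hat{\bm{\beta}}^{FNI}(\bm{y},\lambda_F,\lambda_{NI})=\hat{\bm{\beta}}^{FLNI}(\bm{y},\lambda_F,0,\lambda_{NI})$. Fused groups of a vector $\bm{\beta}\in\mathbb{R}^n$: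 the connected components of the undirected graph on $V$ whose edges are those edges $(\bm{i},\bm{j})\in E$ (orientation ignored) with $\beta_{\bm{i}}=\beta_{\bm{j}}$, i.e. the maximal connected sets of vertices of $G$ on which $\bm{\beta}$ is constant. A fused group is non-zero if the common value of $\bm{\beta}$ on it is non-zero. Degrees of freedom of an estimator $\hat{\bm{\beta}}(\bm{Y})$ of $\mathring{\bm{\beta}}$ (tuning parameters fixed): $df(\hat{\bm{\beta}}(\bm{Y}))=\frac{1}{\sigma^2}\sum_{i=1}^n\mathrm{Cov}[\hat{\beta}_i(\bm{Y}),Y_i]$. *)

theory Defs
  imports "HOL-Probability.Probability"
begin

section \<open>Isotonic vectors, graphs and incidence matrices\<close>

text \<open>The finite index set is the universe of a type \<open>'n\<close> of class \<open>finite\<close>; a partial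
  order on it is a relation in the sense of \<^const>\<open>partial_order_on\<close>, where \<open>(i, j) \<in> R\<close>
  means that \<open>i\<close> precedes or equals \<open>j\<close>.\<close>

definition isotonic :: "'n rel \<Rightarrow> real ^ 'n::finite \<Rightarrow> bool" where
  "isotonic R \<beta> \<longleftrightarrow> (\<forall>(i, j)\<in>R. \<beta> $ i \<le> \<beta> $ j)"

definition corresponds :: "('n::finite \<times> 'n) set \<Rightarrow> 'n rel \<Rightarrow> bool" where
  "corresponds E R \<longleftrightarrow>
     irrefl E \<and> (\<forall>\<beta> :: real ^ 'n. isotonic R \<beta> \<longleftrightarrow> (\<forall>(i, j)\<in>E. \<beta> $ i \<le> \<beta> $ j))"

text \<open>The oriented incidence matrix has its rows indexed by the edges, a set rather than a
  type. So \<open>incidence e v\<close> is the entry in row \<open>e\<close> and column \<open>v\<close>, and a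
  vector indexed by the edges is a function that is only ever used on the edge set \<open>E\<close>.\<close>

definition incidence :: "'n \<times> 'n \<Rightarrow> 'n \<Rightarrow> real" where
  "incidence e v = (if v = fst e then 1 else if v = snd e then -1 else 0)"

definition incidence_mult :: "real ^ 'n::finite \<Rightarrow> 'n \<times> 'n \<Rightarrow> real" where
  "incidence_mult \<beta> e = (\<Sum>v\<in>UNIV. incidence e v * \<beta> $ v)"

lemma incidence_mult_eq:
  assumes "i \<noteq> j"
  shows "incidence_mult \<beta> (i, j) = \<beta> $ i - \<beta> $ j"
proof -
  have "incidence_mult \<beta> (i, j) =
      (\<Sum>v\<in>UNIV. (if v = i then \<beta> $ v else 0) - (if v = j then \<beta> $ v else 0))"
    unfolding incidence_mult_def using assms
    by (intro sum.cong) (auto simp: incidence_def)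
  also have "\<dots> = \<beta> $ i - \<beta> $ j"
    by (simp add: sum_subtractf)
  finally show ?thesis .
qed

section \<open>The fused lasso nearly-isotonic approximator\<close>

definition pos_part :: "real \<Rightarrow> real" where
  "pos_part x = x * of_bool (x > 0)"

definition plus_norm_on :: "'i set \<Rightarrow> ('i \<Rightarrow> real) \<Rightarrow> real" where
  "plus_norm_on I z = (\<Sum>i\<in>I. pos_part (z i))"

definition l1_norm_on :: "'i set \<Rightarrow> ('i \<Rightarrow> real) \<Rightarrow> real" where
  "l1_norm_on I z = (\<Sum>i\<in>I. \<bar>z i\<bar>)"

definition FLNI_objective ::
    "('n \<times> 'n) set \<Rightarrow> real ^ 'n::finite \<Rightarrow> real \<Rightarrow> real \<Rightarrow> real \<Rightarrow> real ^ 'n \<Rightarrow> real" where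
  "FLNI_objective E y lF lL lNI \<beta> =
     1/2 * (norm (y - \<beta>))\<^sup>2 + lF * l1_norm_on E (incidence_mult \<beta>)
       + lL * l1_norm_on UNIV (($) \<beta>) + lNI * plus_norm_on E (incidence_mult \<beta>)"

definition FLNI ::
    "('n \<times> 'n) set \<Rightarrow> real ^ 'n::finite \<Rightarrow> real \<Rightarrow> real \<Rightarrow> real \<Rightarrow> real ^ 'n" where
  "FLNI E y lF lL lNI = arg_min (FLNI_objective E y lF lL lNI) (\<lambda>_. True)"

definition FNI :: "('n \<times> 'n) set \<Rightarrow> real ^ 'n::finite \<Rightarrow> real \<Rightarrow> real \<Rightarrow> real ^ 'n" where
  "FNI E y lF lNI = FLNI E y lF 0 lNI"

text \<open>For nonnegative tuning parameters the minimizer exists and is unique, so that the choice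
  made by \<^const>\<open>arg_min\<close> is immaterial.\<close>

lemma pos_part_eq_max: "pos_part x = max 0 x"
  by (auto simp: pos_part_def)

lemma penalty_convex:
  fixes a b :: "real ^ 'n::finite"
  shows "l1_norm_on E (incidence_mult ((1/2) *\<^sub>R (a + b)))
           \<le> (l1_norm_on E (incidence_mult a) + l1_norm_on E (incidence_mult b)) / 2"
    and "plus_norm_on E (incidence_mult ((1/2) *\<^sub>R (a + b)))
           \<le> (plus_norm_on E (incidence_mult a) + plus_norm_on E (incidence_mult b)) / 2"
    and "l1_norm_on UNIV (($) ((1/2) *\<^sub>R (a + b)))
           \<le> (l1_norm_on UNIV (($) a) + l1_norm_on UNIV (($) b)) / 2"
proof -
  have lin: "incidence_mult ((1/2) *\<^sub>R (a + b)) e = (incidence_mult a e + incidence_mult b e) / 2"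
    for e
    unfolding incidence_mult_def
    by (simp add: sum_divide_distrib flip: sum.distrib) (simp add: field_simps)
  show "l1_norm_on E (incidence_mult ((1/2) *\<^sub>R (a + b)))
           \<le> (l1_norm_on E (incidence_mult a) + l1_norm_on E (incidence_mult b)) / 2"
    unfolding l1_norm_on_def lin sum.distrib[symmetric] sum_divide_distrib
    by (intro sum_mono) (use abs_triangle_ineq in simp)
  show "plus_norm_on E (incidence_mult ((1/2) *\<^sub>R (a + b)))
           \<le> (plus_norm_on E (incidence_mult a) + plus_norm_on E (incidence_mult b)) / 2"
    unfolding plus_norm_on_def lin sum.distrib[symmetric] sum_divide_distrib pos_part_eq_max
    by (intro sum_mono) (simp add: max_def field_simps)
  show "l1_norm_on UNIV (($) ((1/2) *\<^sub>R (a + b)))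
           \<le> (l1_norm_on UNIV (($) a) + l1_norm_on UNIV (($) b)) / 2"
    unfolding l1_norm_on_def sum.distrib[symmetric] sum_divide_distrib
    by (intro sum_mono) (use abs_triangle_ineq in simp)
qed

lemma FLNI_unique_minimizer:
  fixes y :: "real ^ 'n::finite"
  assumes "lF \<ge> 0" "lL \<ge> 0" "lNI \<ge> 0"
  shows "\<exists>!\<beta>. is_arg_min (FLNI_objective E y lF lL lNI) (\<lambda>_. True) \<beta>"
proof -
  let ?f = "FLNI_objective E y lF lL lNI"
  have lower: "1/2 * (norm (y - \<beta>))\<^sup>2 \<le> ?f \<beta>" for \<beta>
  proof -
    have "0 \<le> l1_norm_on E (incidence_mult \<beta>)" "0 \<le> l1_norm_on UNIV (($) \<beta>)"
      "0 \<le> plus_norm_on E (incidence_mult \<beta>)"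
      by (auto simp: l1_norm_on_def plus_norm_on_def pos_part_def intro!: sum_nonneg)
    then show ?thesis
      unfolding FLNI_objective_def using assms by simp
  qed
  have cont: "continuous_on S ?f" for S
    unfolding FLNI_objective_def l1_norm_on_def plus_norm_on_def pos_part_eq_max
      incidence_mult_def
    by (intro continuous_intros)
  define r where "r = sqrt (2 * ?f y)"
  have fy: "0 \<le> ?f y"
    using lower[of y] by simp
  obtain b where b: "b \<in> cball y r" and bmin: "\<And>c. c \<in> cball y r \<Longrightarrow> ?f b \<le> ?f c"
    using continuous_attains_inf[of "cball y r" ?f] cont fy
    by (auto simp: r_def)
  have bmin': "?f b \<le> ?f c" for c
  proof (cases "c \<in> cball y r")
    case False
    then have "r < norm (y - c)"
      by (simp add: dist_norm)
    then have "2 * ?f y < (norm (y - c))\<^sup>2"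
      using real_le_rsqrt[of "norm (y - c)" "2 * ?f y"] by (force simp: r_def)
    moreover have "?f b \<le> ?f y"
      using bmin[of y] fy by (simp add: r_def)
    ultimately show ?thesis
      using lower[of c] by linarith
  qed (use bmin in blast)
  have uniq: "c = b" if c: "\<And>d. ?f c \<le> ?f d" for c
  proof -
    let ?m = "(1/2) *\<^sub>R (b + c)"
    have "(norm (y - ?m))\<^sup>2
        = ((norm (y - b))\<^sup>2 + (norm (y - c))\<^sup>2) / 2 - (norm (b - c))\<^sup>2 / 4"
      unfolding power2_norm_eq_inner
      by (simp add: algebra_simps inner_commute) (simp add: field_simps)
    then have "?f ?m \<le> (?f b + ?f c) / 2 - (norm (b - c))\<^sup>2 / 8"
      using mult_left_mono[OF penalty_convex(1)[of E b c] assms(1)]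
        mult_left_mono[OF penalty_convex(3)[of b c] assms(2)]
        mult_left_mono[OF penalty_convex(2)[of E b c] assms(3)]
      unfolding FLNI_objective_def by (simp add: field_simps)
    moreover have "?f c \<le> ?f ?m" "?f b \<le> ?f ?m"
      using c bmin' by blast+
    moreover have "d \<le> 0" if "m \<le> (p + q) / 2 - d / 8" "q \<le> m" "p \<le> m" for d m p q :: real
      using that by (simp add: field_simps)
    ultimately have "(norm (b - c))\<^sup>2 \<le> 0"
      by blast
    then show "c = b"
      by simp
  qed
  show ?thesis
  proof (rule ex1I[of _ b])
    show "is_arg_min ?f (\<lambda>_. True) b"
      using bmin' by (simp add: is_arg_min_linorder)
  qed (use uniq in \<open>auto simp: is_arg_min_linorder\<close>)
qed

section \<open>Fused groups\<close>

text \<open>The vertex sets of the connected components of the undirected graph whose edges are the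
  edges of \<open>E\<close> with equal values of \<open>\<beta>\<close> at their endpoints.\<close>

definition fused_edges :: "('n \<times> 'n) set \<Rightarrow> real ^ 'n::finite \<Rightarrow> ('n \<times> 'n) set" where
  "fused_edges E \<beta> = {(i, j) \<in> E. \<beta> $ i = \<beta> $ j}"

definition fused_groups :: "('n \<times> 'n) set \<Rightarrow> real ^ 'n::finite \<Rightarrow> 'n set set" where
  "fused_groups E \<beta> = UNIV // (fused_edges E \<beta> \<union> (fused_edges E \<beta>)\<inverse>)\<^sup>*"

definition nonzero_fused_groups :: "('n \<times> 'n) set \<Rightarrow> real ^ 'n::finite \<Rightarrow> 'n set set" where
  "nonzero_fused_groups E \<beta> = {C \<in> fused_groups E \<beta>. \<forall>i\<in>C. \<beta> $ i \<noteq> 0}"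

definition K_FNI :: "('n \<times> 'n) set \<Rightarrow> real ^ 'n::finite \<Rightarrow> real \<Rightarrow> real \<Rightarrow> nat" where
  "K_FNI E y lF lNI = card (fused_groups E (FNI E y lF lNI))"

definition K_FLNI :: "('n \<times> 'n) set \<Rightarrow> real ^ 'n::finite \<Rightarrow> real \<Rightarrow> real \<Rightarrow> real \<Rightarrow> nat" where
  "K_FLNI E y lF lL lNI = card (nonzero_fused_groups E (FLNI E y lF lL lNI))"

section \<open>Gaussian noise and degrees of freedom\<close>

definition multivariate_normal_density ::
    "real ^ 'n::finite \<Rightarrow> real ^ 'n ^ 'n \<Rightarrow> real ^ 'n \<Rightarrow> real" where
  "multivariate_normal_density \<mu> S x =
     exp (- ((x - \<mu>) \<bullet> (matrix_inv S *v (x - \<mu>))) / 2) / sqrt ((2 * pi) ^ CARD('n) * det S)"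

text \<open>With covariance \<open>\<sigma>\<^sup>2 I\<close> this is the density of independent centred normal coordinates.\<close>

lemma multivariate_normal_density_isotropic:
  fixes x :: "real ^ 'n::finite"
  assumes "\<sigma> > 0"
  shows "multivariate_normal_density 0 (mat (\<sigma>\<^sup>2)) x = (\<Prod>i\<in>UNIV. normal_density 0 \<sigma> (x $ i))"
proof -
  have mm: "mat a ** mat b = (mat (a * b) :: real ^ 'n ^ 'n)" for a b :: real
    by (simp add: matrix_matrix_mult_def mat_def vec_eq_iff if_distrib[of "\<lambda>x. _ * x"]
        if_distrib[of "\<lambda>x. x * _"] cong: if_cong)
  have "invertible (mat (\<sigma>\<^sup>2) :: real ^ 'n ^ 'n)"
    unfolding invertible_def
    by (rule exI[of _ "mat (1 / \<sigma>\<^sup>2)"]) (use assms in \<open>simp add: mm\<close>)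
  then have "matrix_inv (mat (\<sigma>\<^sup>2) :: real ^ 'n ^ 'n) ** mat (\<sigma>\<^sup>2) = mat 1"
    unfolding invertible_def matrix_inv_def by (rule someI2_ex) blast
  then have "matrix_inv (mat (\<sigma>\<^sup>2) :: real ^ 'n ^ 'n) ** (mat (\<sigma>\<^sup>2) ** mat (1 / \<sigma>\<^sup>2)) = mat (1 / \<sigma>\<^sup>2)"
    by (simp add: matrix_mul_assoc)
  then have inv: "matrix_inv (mat (\<sigma>\<^sup>2)) = (mat (1 / \<sigma>\<^sup>2) :: real ^ 'n ^ 'n)"
    using assms by (simp add: mm)
  have mv: "mat c *v x = c *\<^sub>R x" for c
    by (simp add: matrix_vector_mult_def mat_def vec_eq_iff if_distrib[of "\<lambda>x. x * _"]
        cong: if_cong)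
  have det: "det (mat (\<sigma>\<^sup>2) :: real ^ 'n ^ 'n) = (\<sigma>\<^sup>2) ^ CARD('n)"
    by (subst det_diagonal) (auto simp: mat_def)
  have "(\<Prod>i\<in>UNIV. normal_density 0 \<sigma> (x $ i))
      = exp (\<Sum>i\<in>UNIV. - (x $ i)\<^sup>2 / (2 * \<sigma>\<^sup>2)) / sqrt (2 * pi * \<sigma>\<^sup>2) ^ CARD('n)"
    by (simp add: normal_density_def prod.distrib exp_sum prod_dividef power_one_over)
  also have "(\<Sum>i\<in>UNIV. - (x $ i)\<^sup>2 / (2 * \<sigma>\<^sup>2)) = - (x \<bullet> (1 / \<sigma>\<^sup>2) *\<^sub>R x) / 2"
    by (simp add: inner_vec_def power2_eq_square sum_divide_distrib sum_negf mult_ac)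
  also have "sqrt (2 * pi * \<sigma>\<^sup>2) ^ CARD('n) = sqrt ((2 * pi) ^ CARD('n) * det (mat (\<sigma>\<^sup>2) :: real ^ 'n ^ 'n))"
    by (simp only: det power_mult_distrib[symmetric] real_sqrt_power)
  finally show ?thesis
    by (simp add: multivariate_normal_density_def inv mv)
qed

definition covariance :: "'w measure \<Rightarrow> ('w \<Rightarrow> real) \<Rightarrow> ('w \<Rightarrow> real) \<Rightarrow> real" where
  "covariance M X Z =
     (\<integral>\<omega>. (X \<omega> - (\<integral>\<omega>. X \<omega> \<partial>M)) * (Z \<omega> - (\<integral>\<omega>. Z \<omega> \<partial>M)) \<partial>M)"

text \<open>The Bochner integral of a non-integrable function is \<open>0\<close>; this predicate says that the
  integrals in the definition of the covariance are genuine ones.\<close>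

definition covariance_exists :: "'w measure \<Rightarrow> ('w \<Rightarrow> real) \<Rightarrow> ('w \<Rightarrow> real) \<Rightarrow> bool" where
  "covariance_exists M X Z \<longleftrightarrow>
     integrable M X \<and> integrable M Z \<and> integrable M (\<lambda>\<omega>. X \<omega> * Z \<omega>)"

definition df :: "'w measure \<Rightarrow> real \<Rightarrow> ('w \<Rightarrow> real ^ 'n::finite) \<Rightarrow> ('w \<Rightarrow> real ^ 'n) \<Rightarrow> real" where
  "df M \<sigma> B Y = 1 / \<sigma>\<^sup>2 * (\<Sum>i\<in>UNIV. covariance M (\<lambda>\<omega>. B \<omega> $ i) (\<lambda>\<omega>. Y \<omega> $ i))"

definition df_exists :: "'w measure \<Rightarrow> ('w \<Rightarrow> real ^ 'n::finite) \<Rightarrow> ('w \<Rightarrow> real ^ 'n) \<Rightarrow> bool" where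
  "df_exists M B Y \<longleftrightarrow> (\<forall>i. covariance_exists M (\<lambda>\<omega>. B \<omega> $ i) (\<lambda>\<omega>. Y \<omega> $ i))"

end

theory Submission
  imports Defs
begin

text \<open>
  The estimator is the proximal map \<open>f\<close> of a polyhedral penalty: a sum, over edges and vertices, of
  functions of a linear form that are linear on either side of \<open>0\<close>. Three facts make its
  degrees of freedom equal to an expected number of groups.

  First, \<open>f\<close> is piecewise a projection. Sort the observations \<open>y\<close> into cells by the signs that the
  linear forms take at \<open>f y\<close>. A fit is characterised by \<open>y - f y\<close> being a subgradient of the
  penalty, and the subgradients at a point depend on its signs only; hence the finitely many cells
  are convex, and within a cell \<open>f\<close> moves by the orthogonal projection of the change in \<open>y\<close> onto the
  space of directions that keep the vanishing linear forms at \<open>0\<close> (\<open>prox_diff_on_cell\<close>). The frontier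
  of a convex set is Lebesgue-null, so almost every \<open>y\<close> is interior to its cell and \<open>f\<close> is affine near
  it (\<open>AE_interior_cell\<close>, \<open>eventually_prox_line\<close>).

  Second, the divergence of \<open>f\<close> at such a \<open>y\<close> is the number of groups. The directions in question
  are the vectors that are constant on fused groups and vanish on the groups that are held
  at \<open>0\<close> by the sign of one of their coordinates. The projection replaces a vector by its group averages, so vertex \<open>i\<close>
  contributes \<open>1 / card C\<close> to the trace when its group \<open>C\<close> is free and \<open>0\<close> otherwise, and each
  free group contributes \<open>1\<close> in total (\<open>sum_axis_projection\<close>).

  Third, Stein's identity turns the divergence into a covariance (\<open>stein_identity\<close>). For a Lipschitz
  function \<open>g\<close> the difference quotients of \<open>h \<mapsto> \<integral> g (x + h u) \<phi> x dx\<close> at \<open>0\<close> can be computed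
  by moving either the function or, after a translation, the Gaussian weight; dominated convergence
  applies to both forms.

  The two claims of the theorem differ in whether a group fitted as \<open>0\<close> counts. If the signs of the
  coordinates belong to the pattern, such a group is held at \<open>0\<close>; if single coordinates are not
  penalised, their signs can be left out, and then all groups are free. Both claims are therefore
  instances of \<open>expected_unpinned_groups_eq_df\<close>, for the set \<open>N\<close> of coordinates whose sign belongs to
  the pattern: \<open>N = UNIV\<close> for the fused lasso nearly-isotonic approximator and \<open>N = {}\<close> for the fused
  nearly-isotonic regression.
\<close>

section \<open>Proximal maps of polyhedral penalties\<close>

definition polyhedral_penalty ::
    "'k set \<Rightarrow> ('k \<Rightarrow> 'a::euclidean_space) \<Rightarrow> ('k \<Rightarrow> real) \<Rightarrow> ('k \<Rightarrow> real) \<Rightarrow> 'a \<Rightarrow> real" where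
  "polyhedral_penalty I a p q x =
     (\<Sum>k\<in>I. p k * max 0 (a k \<bullet> x) + q k * max 0 (- (a k \<bullet> x)))"

locale polyhedral_prox =
  fixes I :: "'k set" and a :: "'k \<Rightarrow> 'a::euclidean_space" and p q :: "'k \<Rightarrow> real"
    and f :: "'a \<Rightarrow> 'a"
  assumes finite_I: "finite I"
    and p_nonneg: "k \<in> I \<Longrightarrow> 0 \<le> p k" and q_nonneg: "k \<in> I \<Longrightarrow> 0 \<le> q k"
    and minimizer: "1/2 * (norm (y - f y))\<^sup>2 + polyhedral_penalty I a p q (f y)
                    \<le> 1/2 * (norm (y - x))\<^sup>2 + polyhedral_penalty I a p q x"
begin

abbreviation P :: "'a \<Rightarrow> real" where
  "P \<equiv> polyhedral_penalty I a p q"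

text \<open>The restriction to \<^term>\<open>I\<close> is what makes the set of all patterns finite.\<close>
definition sign_pattern :: "'a \<Rightarrow> 'k \<Rightarrow> real" where
  "sign_pattern x = (\<lambda>k\<in>I. sgn (a k \<bullet> x))"

text \<open>The gradient at \<open>x\<close> of the sum of those terms of the penalty whose linear form does not
  vanish at \<open>x\<close>. It depends on the sign pattern only and represents the penalty on all points of that
  pattern.\<close>
definition slope :: "'a \<Rightarrow> 'a" where
  "slope x = (\<Sum>k\<in>I. (if a k \<bullet> x > 0 then p k else if a k \<bullet> x < 0 then - q k else 0) *\<^sub>R a k)"

text \<open>The linear span of the points with the sign pattern of \<open>x\<close>, given by its equations.\<close>
definition face_space :: "'a \<Rightarrow> 'a set" where
  "face_space x = {d. \<forall>k\<in>I. a k \<bullet> x = 0 \<longrightarrow> a k \<bullet> d = 0}"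

text \<open>For a sublinear \<^term>\<open>P\<close> the subgradient inequality at \<open>x\<close> splits into domination by
  \<^term>\<open>P\<close> everywhere and equality at \<open>x\<close>; in this form it is stable under convex combinations.\<close>
definition subgradient :: "'a \<Rightarrow> 'a \<Rightarrow> bool" where
  "subgradient z x \<longleftrightarrow> (\<forall>w. z \<bullet> w \<le> P w) \<and> z \<bullet> x = P x"

lemma sign_pattern_eq_iff:
  "sign_pattern x = sign_pattern y \<longleftrightarrow> (\<forall>k\<in>I. sgn (a k \<bullet> x) = sgn (a k \<bullet> y))"
  by (auto simp: sign_pattern_def restrict_def fun_eq_iff)

lemma penalty_eq_slope: "P x = slope x \<bullet> x"
  unfolding polyhedral_penalty_def slope_def inner_sum_left
  by (intro sum.cong) (auto simp: max_def)

lemma slope_cong: "sign_pattern x = sign_pattern y \<Longrightarrow> slope x = slope y"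
  unfolding slope_def sign_pattern_eq_iff
  by (intro sum.cong refl) (smt (verit) sgn_greater sgn_less)

lemma face_space_cong: "sign_pattern x = sign_pattern y \<Longrightarrow> face_space x = face_space y"
  unfolding face_space_def sign_pattern_eq_iff by (metis sgn_zero_iff)

lemma self_in_face_space: "x \<in> face_space x"
  by (simp add: face_space_def)

lemma subspace_face_space: "subspace (face_space x)"
  by (auto simp: subspace_def face_space_def inner_add_right)

lemma penalty_add_le: "P (x + y) \<le> P x + P y"
proof -
  have *: "r * max 0 (s + t) \<le> r * max 0 s + r * max 0 t" if "0 \<le> r" for r s t :: real
    using mult_left_mono[OF _ that, of "max 0 (s + t)" "max 0 s + max 0 t"]
    by (simp add: distrib_left)
  show ?thesis
    unfolding polyhedral_penalty_def sum.distrib[symmetric]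
  proof (rule sum_mono)
    fix k assume "k \<in> I"
    then show "p k * max 0 (a k \<bullet> (x + y)) + q k * max 0 (- (a k \<bullet> (x + y)))
      \<le> p k * max 0 (a k \<bullet> x) + q k * max 0 (- (a k \<bullet> x))
        + (p k * max 0 (a k \<bullet> y) + q k * max 0 (- (a k \<bullet> y)))"
      using *[OF p_nonneg, of k "a k \<bullet> x" "a k \<bullet> y"] *[OF q_nonneg, of k "- (a k \<bullet> x)" "- (a k \<bullet> y)"]
      by (simp add: inner_add_right)
  qed
qed

lemma penalty_scale: "0 \<le> t \<Longrightarrow> P (t *\<^sub>R x) = t * P x"
proof -
  assume "0 \<le> t"
  then have *: "max 0 (t * s) = t * max 0 s" for s
    using mult_left_mono[of 0 s t] mult_left_mono[of s 0 t] by (auto simp: max_def)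
  show ?thesis
    unfolding polyhedral_penalty_def sum_distrib_left
    using *[of "- s" for s] by (intro sum.cong refl) (simp add: * distrib_left mult.left_commute)
qed

text \<open>The first-order condition for the minimizer. Moving from \<open>f y\<close> in direction \<open>w\<close> by a small \<open>t\<close> changes
  the squared distance by \<open>- 2 t (y - f y) \<bullet> w\<close> up to order \<open>t\<^sup>2\<close>, so the penalty has to grow at least
  at rate \<open>(y - f y) \<bullet> w\<close>. The direction \<open>- f y\<close>, along which the penalty decreases linearly, gives
  equality at \<open>f y\<close>.\<close>
lemma residual_subgradient: "subgradient (y - f y) (f y)"
proof -
  \<comment> \<open>A linear bound \<open>c\<close> on the growth of the penalty along \<open>w\<close> bounds the slope of the quadratic part.\<close>
  have descent: "(y - f y) \<bullet> w \<le> c"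
    if c: "\<And>t. 0 < t \<Longrightarrow> t \<le> 1 \<Longrightarrow> P (f y + t *\<^sub>R w) \<le> P (f y) + t * c" for w c
  proof -
    have *: "(y - f y) \<bullet> w \<le> c + t * ((norm w)\<^sup>2 / 2)" if t: "0 < t" "t \<le> 1" for t
    proof -
      have "(norm (y - (f y + t *\<^sub>R w)))\<^sup>2
          = (norm (y - f y))\<^sup>2 - 2 * t * ((y - f y) \<bullet> w) + t\<^sup>2 * (norm w)\<^sup>2"
        unfolding power2_norm_eq_inner
        by (simp add: algebra_simps inner_commute power2_eq_square)
      then have "t * ((y - f y) \<bullet> w) \<le> t * (c + t * ((norm w)\<^sup>2 / 2))"
        using minimizer[of y "f y + t *\<^sub>R w"] c[OF t]
        by (simp add: algebra_simps power2_eq_square)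
      with t show ?thesis by simp
    qed
    have "((\<lambda>t. c + t * ((norm w)\<^sup>2 / 2)) \<longlongrightarrow> c + 0 * ((norm w)\<^sup>2 / 2)) (at_right 0)"
      by (intro tendsto_intros)
    moreover have "eventually (\<lambda>t. (y - f y) \<bullet> w \<le> c + t * ((norm w)\<^sup>2 / 2)) (at_right 0)"
      using eventually_at_right_real[of 0 "1::real", OF zero_less_one]
      by (rule eventually_mono) (auto simp del: times_divide_eq_right intro!: *)
    ultimately show ?thesis
      using tendsto_lowerbound trivial_limit_at_right_real by fastforce
  qed
  have le: "(y - f y) \<bullet> w \<le> P w" for w
  proof (rule descent)
    fix t :: real assume "0 < t"
    then show "P (f y + t *\<^sub>R w) \<le> P (f y) + t * P w"
      using penalty_add_le[of "f y" "t *\<^sub>R w"] by (simp add: penalty_scale)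
  qed
  have "(y - f y) \<bullet> (- f y) \<le> - P (f y)"
  proof (rule descent)
    fix t :: real assume "0 < t" "t \<le> 1"
    then show "P (f y + t *\<^sub>R - f y) \<le> P (f y) + t * - P (f y)"
      using penalty_scale[of "1 - t" "f y"] by (simp add: algebra_simps)
  qed
  with le[of "f y"] le show ?thesis
    by (auto simp: subgradient_def intro: antisym)
qed

lemma subgradient_monotone:
  assumes "subgradient z x" "subgradient z' x'"
  shows "0 \<le> (z - z') \<bullet> (x - x')"
proof -
  have "z \<bullet> x = P x" "z' \<bullet> x' = P x'" "z \<bullet> x' \<le> P x'" "z' \<bullet> x \<le> P x"
    using assms by (auto simp: subgradient_def)
  then show ?thesis
    by (simp add: inner_diff_left inner_diff_right)
qed

text \<open>Firm nonexpansiveness, the monotonicity of subgradients rewritten for residuals.\<close>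
lemma norm_sq_prox_diff_le: "(norm (f y - f y'))\<^sup>2 \<le> (y - y') \<bullet> (f y - f y')"
  using subgradient_monotone[OF residual_subgradient residual_subgradient, of y y']
  unfolding power2_norm_eq_inner by (simp add: algebra_simps)

lemma prox_nonexpansive: "norm (f y - f y') \<le> norm (y - y')"
proof (cases "f y = f y'")
  case False
  have "norm (f y - f y') * norm (f y - f y') \<le> norm (y - y') * norm (f y - f y')"
    using norm_sq_prox_diff_le[of y y'] norm_cauchy_schwarz[of "y - y'" "f y - f y'"]
    by (simp add: power2_eq_square)
  with False show ?thesis by simp
qed simp

lemma continuous_on_prox: "continuous_on S f"
proof (rule continuous_onI)
  fix y and e :: real assume "0 < e"
  then show "\<exists>d>0. \<forall>y'\<in>S. dist y' y < d \<longrightarrow> dist (f y') (f y) \<le> e"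
    using order_trans[OF prox_nonexpansive] by (intro exI[of _ e]) (auto simp: dist_norm)
qed

text \<open>Strong monotonicity of \<open>x \<mapsto> x + subgradients at x\<close> leaves no room for two solutions of the
  first-order condition.\<close>
lemma prox_eqI:
  assumes "subgradient (y - x) x"
  shows "f y = x"
proof -
  have "0 \<le> ((y - f y) - (y - x)) \<bullet> (f y - x)"
    by (rule subgradient_monotone[OF residual_subgradient assms])
  also have "((y - f y) - (y - x)) \<bullet> (f y - x) = - (norm (f y - x))\<^sup>2"
    unfolding power2_norm_eq_inner by (simp add: algebra_simps)
  finally show ?thesis by simp
qed

text \<open>Nonzero forms keep their sign under small changes, and the direction is chosen so that the
  vanishing ones stay \<open>0\<close>.\<close>
lemma eventually_same_sign_pattern:
  assumes "d \<in> face_space x"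
  shows "eventually (\<lambda>t. sign_pattern (x + t *\<^sub>R d) = sign_pattern x) (at 0)"
proof -
  have "eventually (\<lambda>t. sgn (a k \<bullet> (x + t *\<^sub>R d)) = sgn (a k \<bullet> x)) (at 0)" if "k \<in> I" for k
  proof (cases "a k \<bullet> x = 0")
    case True
    then show ?thesis
      using assms that by (auto simp: face_space_def inner_add_right)
  next
    case False
    have "((\<lambda>t. a k \<bullet> (x + t *\<^sub>R d)) \<longlongrightarrow> a k \<bullet> (x + 0 *\<^sub>R d)) (at 0)"
      by (intro tendsto_intros)
    then have lim: "((\<lambda>t. a k \<bullet> (x + t *\<^sub>R d)) \<longlongrightarrow> a k \<bullet> x) (at 0)"
      by simp
    show ?thesis
    proof (cases "a k \<bullet> x > 0")
      case True
      show ?thesis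
        using order_tendstoD(1)[OF lim True] by eventually_elim (use True in simp)
    next
      case neg: False
      with False have "a k \<bullet> x < 0" by simp
      then show ?thesis
        using order_tendstoD(2)[OF lim, of 0] by (auto elim!: eventually_mono)
    qed
  qed
  then have "eventually (\<lambda>t. \<forall>k\<in>I. sgn (a k \<bullet> (x + t *\<^sub>R d)) = sgn (a k \<bullet> x)) (at 0)"
    using finite_I by (simp add: eventually_ball_finite)
  then show ?thesis
    by (simp add: sign_pattern_eq_iff)
qed

text \<open>Along a direction that preserves the pattern the penalty is linear with gradient
  \<^term>\<open>slope x\<close> on both sides of \<open>x\<close>. It dominates the linear function of the subgradient and
  touches it at \<open>x\<close>, so the two linear functions agree.\<close>
lemma subgradient_on_face_space:
  assumes z: "subgradient z x" and d: "d \<in> face_space x"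
  shows "z \<bullet> d = slope x \<bullet> d"
proof -
  have "eventually (\<lambda>t. 0 \<le> t * ((slope x - z) \<bullet> d)) (at 0)"
    using eventually_same_sign_pattern[OF d]
  proof eventually_elim
    case (elim t)
    have "z \<bullet> (x + t *\<^sub>R d) \<le> slope x \<bullet> (x + t *\<^sub>R d)"
      using z slope_cong[OF elim] unfolding subgradient_def by (metis penalty_eq_slope)
    moreover have "z \<bullet> x = slope x \<bullet> x"
      using z by (simp add: subgradient_def penalty_eq_slope)
    ultimately show ?case
      by (simp add: inner_add_right inner_diff_left algebra_simps)
  qed
  then obtain e where e: "e > 0" "\<And>t. t \<noteq> 0 \<Longrightarrow> \<bar>t\<bar> < e \<Longrightarrow> 0 \<le> t * ((slope x - z) \<bullet> d)"
    by (auto simp: eventually_at)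
  from e(2)[of "e / 2"] e(2)[of "- (e / 2)"] e(1) have "(slope x - z) \<bullet> d = 0"
    by (simp add: zero_le_mult_iff mult_le_0_iff)
  then show ?thesis
    by (simp add: inner_diff_left)
qed

text \<open>The subdifferential is constant on each set of points with a common pattern.\<close>
lemma subgradient_cong:
  assumes z: "subgradient z x" and eq: "sign_pattern x = sign_pattern x'"
  shows "subgradient z x'"
proof -
  have "x' \<in> face_space x"
    using face_space_cong[OF eq] self_in_face_space by simp
  then have "z \<bullet> x' = P x'"
    using subgradient_on_face_space[OF z] slope_cong[OF eq] by (simp add: penalty_eq_slope)
  with z show ?thesis
    by (simp add: subgradient_def)
qed

definition cell :: "('k \<Rightarrow> real) \<Rightarrow> 'a set" where
  "cell s = {y. sign_pattern (f y) = s}"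

lemma sign_pattern_convex_comb:
  assumes "sign_pattern x = s" "sign_pattern x' = s" "0 \<le> u" "0 \<le> v" "u + v = 1"
  shows "sign_pattern (u *\<^sub>R x + v *\<^sub>R x') = s"
proof -
  have "sgn (u * r + v * r') = sgn r" if same: "sgn r = sgn r'" for r r' :: real
  proof -
    consider "r > 0" "r' > 0" | "r < 0" "r' < 0" | "r = 0" "r' = 0"
      using same by (cases r "0::real" rule: linorder_cases; cases r' "0::real" rule: linorder_cases; simp)
    then show ?thesis
    proof cases
      case 1
      then have "0 < u * r + v * r'"
        using convex_bound_lt[of "- r" 0 "- r'" u v] assms(3-5) by simp
      with 1 show ?thesis by simp
    next
      case 2
      then have "u * r + v * r' < 0"
        using convex_bound_lt[of r 0 r' u v] assms(3-5) by simp
      with 2 show ?thesis by simp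
    qed simp
  qed
  then have "sign_pattern (u *\<^sub>R x + v *\<^sub>R x') = sign_pattern x"
    using assms(1,2) unfolding sign_pattern_eq_iff
    by (simp add: inner_add_right) (metis sign_pattern_eq_iff)
  with assms show ?thesis by simp
qed

text \<open>If \<open>y\<close> and \<open>y'\<close> share a pattern, both residuals are subgradients at every point of that pattern, in
  particular at a convex combination \<open>x\<close> of the fits. So the same combination of residuals is a
  subgradient at \<open>x\<close>, and \<open>x\<close> is the fit of the combined observation.\<close>
lemma convex_cell: "convex (cell s)"
proof (rule convexI)
  fix y y' and u v :: real
  assume y: "y \<in> cell s" "y' \<in> cell s" and uv: "0 \<le> u" "0 \<le> v" "u + v = 1"
  define x where "x = u *\<^sub>R f y + v *\<^sub>R f y'"
  have x: "sign_pattern x = s"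
    unfolding x_def using y uv by (intro sign_pattern_convex_comb) (auto simp: cell_def)
  have sub: "subgradient (y - f y) x" "subgradient (y' - f y') x"
    using subgradient_cong[OF residual_subgradient] x y by (auto simp: cell_def)
  define z where "z = u *\<^sub>R (y - f y) + v *\<^sub>R (y' - f y')"
  have "subgradient z x"
    unfolding subgradient_def
  proof (intro conjI allI)
    fix w
    show "z \<bullet> w \<le> P w"
      using sub uv convex_bound_le[of "(y - f y) \<bullet> w" "P w" "(y' - f y') \<bullet> w" u v]
      unfolding z_def by (simp add: subgradient_def inner_add_left)
    have "z \<bullet> x = u * P x + v * P x"
      using sub unfolding z_def by (simp add: subgradient_def inner_add_left)
    also have "\<dots> = P x"
      using uv by (simp flip: distrib_right)
    finally show "z \<bullet> x = P x" .
  qed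
  moreover have "z = (u *\<^sub>R y + v *\<^sub>R y') - x"
    by (simp add: z_def x_def algebra_simps)
  ultimately have "f (u *\<^sub>R y + v *\<^sub>R y') = x"
    by (intro prox_eqI) simp
  with x show "u *\<^sub>R y + v *\<^sub>R y' \<in> cell s"
    by (simp add: cell_def)
qed

text \<open>Within a cell the change of the fit is the orthogonal projection of the change of the
  observation: the fits differ by an element of the face space, and the residuals differ by a vector
  orthogonal to it, because both represent \<^term>\<open>slope (f y)\<close> there. The projection enters as
  a vector \<open>d\<close> with its two defining properties.\<close>
lemma prox_diff_on_cell:
  assumes "sign_pattern (f y') = sign_pattern (f y)" "d \<in> face_space (f y)"
    and orth: "\<And>v. v \<in> face_space (f y) \<Longrightarrow> (y' - y - d) \<bullet> v = 0"
  shows "f y' = f y + d"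
proof -
  let ?V = "face_space (f y)"
  have V: "f y' \<in> ?V" "f y \<in> ?V"
    using self_in_face_space face_space_cong[OF assms(1)] by auto
  \<comment> \<open>The error \<open>e\<close> lies in the face space and is orthogonal to it, hence vanishes.\<close>
  define e where "e = f y' - f y - d"
  have e: "e \<in> ?V"
    unfolding e_def using V assms(2) by (intro subspace_diff subspace_face_space)
  have "(y - f y) \<bullet> e = (y' - f y') \<bullet> e"
    using subgradient_on_face_space[OF residual_subgradient, of e y]
      subgradient_on_face_space[OF residual_subgradient, of e y'] e
      slope_cong[OF assms(1)] face_space_cong[OF assms(1)] by simp
  then have "e \<bullet> e = (y' - y - d) \<bullet> e"
    by (simp add: e_def inner_diff_left)
  also have "\<dots> = 0"
    by (rule orth[OF e])
  finally have "e = 0" by simp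
  then show ?thesis
    by (simp add: e_def algebra_simps)
qed

lemma finite_sign_patterns: "finite (range sign_pattern)"
proof (rule finite_subset)
  show "range sign_pattern \<subseteq> (\<Pi>\<^sub>E k\<in>I. {-1, 0, 1})"
    by (rule image_subsetI) (simp add: sign_pattern_def restrict_PiE_iff sgn_if)
  show "finite (\<Pi>\<^sub>E k\<in>I. {-1, 0, 1 :: real})"
    by (intro finite_PiE finite_I) simp
qed

text \<open>There are finitely many cells, and the frontier of a convex set is a null set.\<close>
lemma AE_interior_cell: "AE y in lborel. y \<in> interior (cell (sign_pattern (f y)))"
proof -
  have "AE y in lborel. y \<notin> frontier (cell s)" for s
  proof (rule AE_not_in)
    have "frontier (cell s) \<in> null_sets lebesgue"
      using negligible_convex_frontier[OF convex_cell] by (simp add: negligible_iff_null_sets)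
    then show "frontier (cell s) \<in> null_sets lborel"
      by (subst (asm) null_sets_completion_iff) simp_all
  qed
  then have "AE y in lborel. \<forall>s\<in>range sign_pattern. y \<notin> frontier (cell s)"
    by (intro AE_finite_allI finite_sign_patterns)
  then show ?thesis
  proof eventually_elim
    case (elim y)
    have "y \<in> closure (cell (sign_pattern (f y)))"
      by (rule subsetD[OF closure_subset]) (simp add: cell_def)
    with elim show ?case
      by (auto simp: frontier_def)
  qed
qed

lemma eventually_prox_line:
  assumes y: "y \<in> interior (cell (sign_pattern (f y)))"
    and d: "d \<in> face_space (f y)" "\<And>v. v \<in> face_space (f y) \<Longrightarrow> (u - d) \<bullet> v = 0"
  shows "eventually (\<lambda>t. f (y + t *\<^sub>R u) = f y + t *\<^sub>R d) (at 0)"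
proof -
  have "((\<lambda>t. y + t *\<^sub>R u) \<longlongrightarrow> y + 0 *\<^sub>R u) (at 0)"
    by (intro tendsto_intros)
  then have "((\<lambda>t. y + t *\<^sub>R u) \<longlongrightarrow> y) (at 0)"
    by simp
  from topological_tendstoD[OF this open_interior y] show ?thesis
  proof eventually_elim
    case (elim t)
    then have "sign_pattern (f (y + t *\<^sub>R u)) = sign_pattern (f y)"
      using interior_subset by (force simp: cell_def)
    then show ?case
    proof (rule prox_diff_on_cell)
      show "t *\<^sub>R d \<in> face_space (f y)"
        by (intro subspace_mul subspace_face_space d)
      fix v assume v: "v \<in> face_space (f y)"
      have "(y + t *\<^sub>R u - y - t *\<^sub>R d) \<bullet> v = t * ((u - d) \<bullet> v)"
        by (simp add: algebra_simps)
      with d(2)[OF v] show "(y + t *\<^sub>R u - y - t *\<^sub>R d) \<bullet> v = 0"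
        by simp
    qed
  qed
qed

lemma sign_pattern_prox_measurable:
  "(\<lambda>y. sign_pattern (f y)) \<in> borel \<rightarrow>\<^sub>M count_space (range sign_pattern)"
proof -
  have [measurable]: "f \<in> borel_measurable borel"
    by (intro borel_measurable_continuous_onI continuous_on_prox)
  have "(\<lambda>y. sign_pattern (f y)) -` {sign_pattern x} \<inter> space borel \<in> sets borel" for x
  proof -
    have "(\<lambda>y. sign_pattern (f y)) -` {sign_pattern x} \<inter> space borel
      = {y \<in> space borel. \<forall>k\<in>I. sgn (a k \<bullet> f y) = sgn (a k \<bullet> x)}"
      by (auto simp: sign_pattern_eq_iff)
    also have "\<dots> \<in> sets borel"
      by (intro sets.sets_Collect_finite_All finite_I) measurable
    finally show ?thesis .
  qed
  then show ?thesis
    using finite_sign_patterns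
    by (subst measurable_count_space_eq_countable) (auto intro: countable_finite)
qed

lemma borel_measurable_pattern_function:
  fixes h :: "'a \<Rightarrow> real"
  assumes "\<And>x x'. sign_pattern x = sign_pattern x' \<Longrightarrow> h x = h x'"
  shows "(\<lambda>y. h (f y)) \<in> borel_measurable borel"
proof -
  have "h (f y) = h (inv sign_pattern (sign_pattern (f y)))" for y
    by (rule assms) (simp add: f_inv_into_f)
  then show ?thesis
    using measurable_compose[OF sign_pattern_prox_measurable, of "\<lambda>s. h (inv sign_pattern s)" borel]
    by simp
qed

end

section \<open>Integration by parts against an isotropic Gaussian weight\<close>

lemma le_exp_self: "r \<le> exp r" for r :: real
  using exp_ge_add_one_self[of r] by linarith

lemma abs_exp_minus_1_le: "\<bar>exp w - 1\<bar> \<le> \<bar>w\<bar> * exp \<bar>w\<bar>" for w :: real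
proof (cases "0 \<le> w")
  case True
  have "(1 - w) * exp w \<le> exp (- w) * exp w"
    using exp_ge_add_one_self[of "- w"] by (intro mult_right_mono) auto
  with True show ?thesis
    by (simp add: algebra_simps flip: exp_add)
next
  case False
  then have "\<bar>exp w - 1\<bar> \<le> \<bar>w\<bar> * 1"
    using exp_le_one_iff[of w] exp_ge_add_one_self[of w] by linarith
  also have "\<dots> \<le> \<bar>w\<bar> * exp \<bar>w\<bar>"
    by (intro mult_left_mono) auto
  finally show ?thesis .
qed

text \<open>A centred isotropic Gaussian weight, up to a constant factor.\<close>
locale isotropic_gaussian =
  fixes \<phi> :: "'a::euclidean_space \<Rightarrow> real" and c \<sigma> :: real
  assumes \<sigma>_pos: "0 < \<sigma>" and c_nonneg: "0 \<le> c"
    and density: "\<phi> x = c * exp (- (norm x)\<^sup>2 / (2 * \<sigma>\<^sup>2))"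
    and integrable_density: "integrable lborel \<phi>"
begin

lemma density_nonneg: "0 \<le> \<phi> x"
  using c_nonneg by (simp add: density)

lemma density_measurable [measurable]: "\<phi> \<in> borel_measurable borel"
  using integrable_density by auto

text \<open>Translating the weight multiplies it by an exponential of a linear function. This yields both
  the exponential moments of the weight and its logarithmic derivative.\<close>
lemma density_shift:
  assumes "norm u = 1"
  shows "\<phi> (x - h *\<^sub>R u) = \<phi> x * exp ((h * (x \<bullet> u) - h\<^sup>2 / 2) / \<sigma>\<^sup>2)"
proof -
  have "(norm (x - h *\<^sub>R u))\<^sup>2 = (norm x)\<^sup>2 - 2 * h * (x \<bullet> u) + h\<^sup>2 * (norm u)\<^sup>2"
    unfolding power2_norm_eq_inner by (simp add: algebra_simps inner_commute power2_eq_square)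
  then have "- (norm (x - h *\<^sub>R u))\<^sup>2 = - (norm x)\<^sup>2 + 2 * (h * (x \<bullet> u) - h\<^sup>2 / 2)"
    using assms by simp
  then have "- (norm (x - h *\<^sub>R u))\<^sup>2 / (2 * \<sigma>\<^sup>2)
      = - (norm x)\<^sup>2 / (2 * \<sigma>\<^sup>2) + 2 * (h * (x \<bullet> u) - h\<^sup>2 / 2) / (2 * \<sigma>\<^sup>2)"
    by (simp only: add_divide_distrib)
  then have "- (norm (x - h *\<^sub>R u))\<^sup>2 / (2 * \<sigma>\<^sup>2)
      = - (norm x)\<^sup>2 / (2 * \<sigma>\<^sup>2) + (h * (x \<bullet> u) - h\<^sup>2 / 2) / \<sigma>\<^sup>2"
    by (simp only: mult_divide_mult_cancel_left_if) simp
  then show ?thesis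
    by (simp only: density exp_add mult.assoc)
qed

lemma integrable_translate:
  fixes F :: "'a \<Rightarrow> real"
  assumes "integrable lborel F"
  shows "integrable lborel (\<lambda>x. F (v + x))"
    and "(\<integral>x. F (v + x) \<partial>lborel) = (\<integral>x. F x \<partial>lborel)"
proof -
  have [measurable]: "F \<in> borel_measurable borel"
    using assms by auto
  show "integrable lborel (\<lambda>x. F (v + x))"
    using assms integrable_distr_eq[of "(+) v" lborel borel F] by (simp add: lborel_distr_plus)
  show "(\<integral>x. F (v + x) \<partial>lborel) = (\<integral>x. F x \<partial>lborel)"
    using integral_distr[of "(+) v" lborel borel F] by (simp add: lborel_distr_plus)
qed

text \<open>Exponential tilting: up to a constant, the integrand is a translate of the weight.\<close>
lemma integrable_exp_inner:
  assumes u: "norm u = 1"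
  shows "integrable lborel (\<lambda>x. \<phi> x * exp (k * (x \<bullet> u)))"
proof -
  have "\<phi> (- ((k * \<sigma>\<^sup>2) *\<^sub>R u) + x) * exp (k\<^sup>2 * \<sigma>\<^sup>2 / 2) = \<phi> x * exp (k * (x \<bullet> u))" for x
  proof -
    have "\<phi> (- ((k * \<sigma>\<^sup>2) *\<^sub>R u) + x) = \<phi> x * exp (k * (x \<bullet> u) - k\<^sup>2 * \<sigma>\<^sup>2 / 2)"
      using density_shift[OF u, of x "k * \<sigma>\<^sup>2"] \<sigma>_pos
      by (simp add: diff_divide_distrib power2_eq_square)
    then show ?thesis
      by (simp add: mult.assoc flip: exp_add)
  qed
  moreover have "integrable lborel (\<lambda>x. \<phi> (- ((k * \<sigma>\<^sup>2) *\<^sub>R u) + x) * exp (k\<^sup>2 * \<sigma>\<^sup>2 / 2))"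
    by (intro integrable_mult_left integrable_translate integrable_density)
  ultimately show ?thesis by simp
qed

text \<open>The exponential of a norm is bounded by a finite sum of exponentials of linear functions, namely
  the two signs of the largest coordinate, which reduces the claim to exponential tilting.\<close>
lemma integrable_exp_growth:
  fixes F :: "'a \<Rightarrow> real"
  assumes [measurable]: "F \<in> borel_measurable borel"
    and bound: "\<And>x. \<bar>F x\<bar> \<le> A * exp (k * norm x)" and "0 \<le> k"
  shows "integrable lborel (\<lambda>x. \<phi> x * F x)"
proof -
  \<comment> \<open>The norm is at most \<open>sqrt DIM('a)\<close> times the largest coordinate in absolute value.\<close>
  define k' where "k' = k * sqrt (real DIM('a))"
  define W where "W x = (\<Sum>b\<in>Basis. exp (k' * (x \<bullet> b)) + exp (- k' * (x \<bullet> b)))" for x :: 'a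
  have A: "0 \<le> A" using bound[of 0] by simp
  have W: "exp (k * norm x) \<le> W x" for x :: 'a
  proof -
    have "infnorm x \<in> (\<lambda>b. \<bar>x \<bullet> b\<bar>) ` Basis"
      unfolding infnorm_Max by (intro Max_in) auto
    then obtain b where b: "b \<in> Basis" "infnorm x = \<bar>x \<bullet> b\<bar>" by auto
    have "norm x \<le> sqrt (real DIM('a)) * \<bar>x \<bullet> b\<bar>"
      using norm_le_infnorm[of x] b by simp
    from mult_left_mono[OF this \<open>0 \<le> k\<close>] have "k * norm x \<le> k' * \<bar>x \<bullet> b\<bar>"
      by (simp add: k'_def mult.assoc)
    then have "exp (k * norm x) \<le> exp (k' * \<bar>x \<bullet> b\<bar>)"
      by simp
    also have "\<dots> \<le> exp (k' * (x \<bullet> b)) + exp (- k' * (x \<bullet> b))"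
      by (cases "0 \<le> x \<bullet> b") auto
    also have "\<dots> \<le> W x"
      unfolding W_def
      by (rule member_le_sum[OF b(1), where f = "\<lambda>b. exp (k' * (x \<bullet> b)) + exp (- k' * (x \<bullet> b))"])
        (auto intro: add_nonneg_nonneg)
    finally show ?thesis .
  qed
  have "integrable lborel (\<lambda>x. A * (\<Sum>b\<in>Basis. \<phi> x * exp (k' * (x \<bullet> b)) + \<phi> x * exp (- k' * (x \<bullet> b))))"
    by (intro integrable_mult_right Bochner_Integration.integrable_sum
        Bochner_Integration.integrable_add integrable_exp_inner) auto
  then show ?thesis
  proof (rule Bochner_Integration.integrable_bound)
    show "AE x in lborel. norm (\<phi> x * F x)
        \<le> norm (A * (\<Sum>b\<in>Basis. \<phi> x * exp (k' * (x \<bullet> b)) + \<phi> x * exp (- k' * (x \<bullet> b))))"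
    proof (rule AE_I2)
      fix x
      have "\<bar>\<phi> x * F x\<bar> \<le> \<phi> x * (A * W x)"
        using density_nonneg[of x] order_trans[OF bound mult_left_mono[OF W A]]
        by (auto simp: abs_mult intro!: mult_left_mono)
      also have "\<dots> = A * (\<Sum>b\<in>Basis. \<phi> x * exp (k' * (x \<bullet> b)) + \<phi> x * exp (- k' * (x \<bullet> b)))"
        by (simp add: W_def sum_distrib_left distrib_left mult_ac)
      finally show "norm (\<phi> x * F x)
        \<le> norm (A * (\<Sum>b\<in>Basis. \<phi> x * exp (k' * (x \<bullet> b)) + \<phi> x * exp (- k' * (x \<bullet> b))))"
        by simp
    qed
  qed measurable
qed

lemma lipschitz_borel_measurable:
  fixes g :: "'a \<Rightarrow> real"
  assumes lip: "\<And>x y. \<bar>g x - g y\<bar> \<le> norm (x - y)"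
  shows "g \<in> borel_measurable borel"
proof (rule borel_measurable_continuous_onI, rule continuous_onI)
  fix x and e :: real assume "0 < e"
  then show "\<exists>d>0. \<forall>x'\<in>UNIV. dist x' x < d \<longrightarrow> dist (g x') (g x) \<le> e"
    using order_trans[OF lip] by (intro exI[of _ e]) (auto simp: dist_norm)
qed

lemma lipschitz_exp_growth:
  fixes g :: "'a \<Rightarrow> real"
  assumes lip: "\<And>x y. \<bar>g x - g y\<bar> \<le> norm (x - y)"
  shows "\<bar>g x\<bar> \<le> (\<bar>g 0\<bar> + 1) * exp (norm x)"
proof -
  have "\<bar>g x\<bar> \<le> \<bar>g 0\<bar> * 1 + norm x"
    using lip[of x 0] by simp
  also have "\<dots> \<le> \<bar>g 0\<bar> * exp (norm x) + exp (norm x)"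
    using le_exp_self by (intro add_mono mult_left_mono) auto
  finally show ?thesis by (simp add: algebra_simps)
qed

lemma integrable_lipschitz:
  fixes g :: "'a \<Rightarrow> real"
  assumes lip: "\<And>x y. \<bar>g x - g y\<bar> \<le> norm (x - y)"
  shows "integrable lborel (\<lambda>x. \<phi> x * g x)"
  by (rule integrable_exp_growth[where A = "\<bar>g 0\<bar> + 1" and k = 1])
    (use lipschitz_borel_measurable[OF lip] lipschitz_exp_growth[of g, OF lip] in auto)

lemma integrable_lipschitz_mult_inner:
  fixes g :: "'a \<Rightarrow> real"
  assumes lip: "\<And>x y. \<bar>g x - g y\<bar> \<le> norm (x - y)" and u: "norm u = 1"
  shows "integrable lborel (\<lambda>x. \<phi> x * (g x * (x \<bullet> u)))"
proof (rule integrable_exp_growth)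
  have [measurable]: "g \<in> borel_measurable borel"
    by (rule lipschitz_borel_measurable[OF lip])
  show "(\<lambda>x. g x * (x \<bullet> u)) \<in> borel_measurable borel"
    by measurable
  fix x
  have "\<bar>x \<bullet> u\<bar> \<le> norm x"
    using Cauchy_Schwarz_ineq2[of x u] u by simp
  then have "\<bar>x \<bullet> u\<bar> \<le> exp (norm x)"
    using le_exp_self by (rule order_trans)
  then have "\<bar>g x\<bar> * \<bar>x \<bullet> u\<bar> \<le> ((\<bar>g 0\<bar> + 1) * exp (norm x)) * exp (norm x)"
    using lipschitz_exp_growth[of g, OF lip] by (intro mult_mono) auto
  then show "\<bar>g x * (x \<bullet> u)\<bar> \<le> (\<bar>g 0\<bar> + 1) * exp (2 * norm x)"
    by (simp add: abs_mult mult.assoc flip: exp_add)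
qed simp

text \<open>Differentiate \<open>h \<mapsto> \<integral> g (x + h u) \<phi> x dx = \<integral> g x \<phi> (x - h u) dx\<close> at \<open>h = 0\<close> in both forms. In the first
  the difference quotient of \<open>g\<close> is bounded by \<open>1\<close>. In the second that of \<open>\<phi>\<close> is bounded by \<open>\<phi>\<close>
  times an exponential of the norm, and \<open>g\<close> grows at most linearly. Almost everywhere
  differentiability of \<open>g\<close> in the direction \<open>u\<close> suffices because the Lipschitz bound rules out a
  singular part.\<close>
theorem stein_identity:
  fixes g D :: "'a \<Rightarrow> real"
  assumes u: "norm u = 1"
    and lip: "\<And>x y. \<bar>g x - g y\<bar> \<le> norm (x - y)"
    and D [measurable]: "D \<in> borel_measurable borel"
    and deriv: "AE x in lborel. ((\<lambda>t. (g (x + t *\<^sub>R u) - g x) / t) \<longlongrightarrow> D x) (at 0)"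
  shows "(\<integral>x. \<phi> x * D x \<partial>lborel) = (\<integral>x. \<phi> x * (g x * (x \<bullet> u)) \<partial>lborel) / \<sigma>\<^sup>2"
    and "integrable lborel (\<lambda>x. \<phi> x * D x)"
proof -
  have [measurable]: "g \<in> borel_measurable borel"
    by (rule lipschitz_borel_measurable[OF lip])
  have g_growth: "\<bar>g x\<bar> \<le> (\<bar>g 0\<bar> + 1) * exp (norm x)" for x
    by (rule lipschitz_exp_growth[of g, OF lip])
  have int_g: "integrable lborel (\<lambda>x. \<phi> x * g x)"
    by (rule integrable_lipschitz[OF lip])
  \<comment> \<open>Dominated convergence works along sequences, so the limit at \<open>0\<close> is taken along one in \<open>(0, 1]\<close>.\<close>
  define h where "h n = inverse (real (Suc n))" for n
  have h: "0 < h n" "h n \<le> 1" for n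
    by (auto simp: h_def field_simps)
  have h_lim: "filterlim h (at 0) sequentially"
    unfolding filterlim_at h_def using LIMSEQ_inverse_real_of_nat by auto

  have bnd: "integrable lborel \<phi>" by (rule integrable_density)
  have lim1: "AE x in lborel. (\<lambda>n. \<phi> x * ((g (x + h n *\<^sub>R u) - g x) / h n)) \<longlonglongrightarrow> \<phi> x * D x"
    using deriv
  proof eventually_elim
    case (elim x)
    from filterlim_compose[OF this h_lim] show ?case
      by (rule tendsto_mult_left)
  qed
  have dom1: "AE x in lborel. norm (\<phi> x * ((g (x + h n *\<^sub>R u) - g x) / h n)) \<le> \<phi> x" for n
  proof (rule AE_I2)
    fix x
    have "\<bar>g (x + h n *\<^sub>R u) - g x\<bar> \<le> h n"
      using lip[of "x + h n *\<^sub>R u" x] u h[of n] by simp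
    then have "\<bar>(g (x + h n *\<^sub>R u) - g x) / h n\<bar> \<le> 1"
      using h(1)[of n] by (simp only: abs_divide abs_of_pos divide_le_eq_1_pos)
    then show "norm (\<phi> x * ((g (x + h n *\<^sub>R u) - g x) / h n)) \<le> \<phi> x"
      using density_nonneg[of x] by (simp only: real_norm_def abs_mult abs_of_nonneg mult_left_le)
  qed
  show "integrable lborel (\<lambda>x. \<phi> x * D x)"
    by (rule integrable_dominated_convergence[OF _ _ bnd lim1 dom1]) measurable
  have lim1': "(\<lambda>n. \<integral>x. \<phi> x * ((g (x + h n *\<^sub>R u) - g x) / h n) \<partial>lborel)
      \<longlonglongrightarrow> (\<integral>x. \<phi> x * D x \<partial>lborel)"
    by (rule integral_dominated_convergence[OF _ _ bnd lim1 dom1]) measurable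

  define w where "w n x = (h n * (x \<bullet> u) - (h n)\<^sup>2 / 2) / \<sigma>\<^sup>2" for n x
  \<comment> \<open>The translation moves the difference quotient from \<open>g\<close> to the weight.\<close>
  have parts: "(\<integral>x. \<phi> x * ((g (x + h n *\<^sub>R u) - g x) / h n) \<partial>lborel)
      = (\<integral>x. \<phi> x * (g x * ((exp (w n x) - 1) / h n)) \<partial>lborel)" for n
  proof -
    have int_gh: "integrable lborel (\<lambda>x. \<phi> x * g (x + h n *\<^sub>R u))"
    proof (rule integrable_exp_growth)
      fix x
      have "\<bar>g (x + h n *\<^sub>R u)\<bar> \<le> (\<bar>g 0\<bar> + 1) * exp (norm (x + h n *\<^sub>R u))"
        by (rule g_growth)
      also have "\<dots> \<le> (\<bar>g 0\<bar> + 1) * exp (1 + 1 * norm x)"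
        using norm_triangle_ineq[of x "h n *\<^sub>R u"] u h[of n] by (intro mult_left_mono) auto
      finally show "\<bar>g (x + h n *\<^sub>R u)\<bar> \<le> (\<bar>g 0\<bar> + 1) * exp 1 * exp (1 * norm x)"
        by (simp only: exp_add mult.assoc)
    qed auto
    have shift: "\<phi> (- (h n *\<^sub>R u) + x) = \<phi> x * exp (w n x)" for x
      using density_shift[OF u, of x "h n"] by (simp add: w_def)
    have eq: "(\<lambda>x. \<phi> (- (h n *\<^sub>R u) + x) * g (- (h n *\<^sub>R u) + x + h n *\<^sub>R u)) = (\<lambda>x. \<phi> x * (g x * exp (w n x)))"
      by (simp only: shift) (simp add: mult_ac)
    note tr = integrable_translate[OF int_gh, of "- (h n *\<^sub>R u)", unfolded eq]
    have "(\<integral>x. \<phi> x * ((g (x + h n *\<^sub>R u) - g x) / h n) \<partial>lborel)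
        = (\<integral>x. \<phi> x * g (x + h n *\<^sub>R u) - \<phi> x * g x \<partial>lborel) / h n"
      by (simp add: right_diff_distrib)
    also have "\<dots> = ((\<integral>x. \<phi> x * (g x * exp (w n x)) \<partial>lborel) - (\<integral>x. \<phi> x * g x \<partial>lborel)) / h n"
      using int_gh int_g tr(2) by simp
    also have "\<dots> = (\<integral>x. \<phi> x * (g x * exp (w n x)) - \<phi> x * g x \<partial>lborel) / h n"
      using tr(1) int_g by simp
    also have "\<dots> = (\<integral>x. \<phi> x * (g x * ((exp (w n x) - 1) / h n)) \<partial>lborel)"
      by (simp add: right_diff_distrib)
    finally show ?thesis .
  qed
  \<comment> \<open>Twice the bound \<open>(norm x + 1) / \<sigma>\<^sup>2\<close> on \<open>\<bar>w n x\<bar> / h n\<close> is \<open>m * norm x + m\<close>.\<close>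
  define m where "m = 2 / \<sigma>\<^sup>2"
  have "integrable lborel (\<lambda>x. \<phi> x * ((\<bar>g 0\<bar> + 1) * exp m * exp ((1 + m) * norm x)))"
    using \<sigma>_pos by (intro integrable_exp_growth[where A = "(\<bar>g 0\<bar> + 1) * exp m" and k = "1 + m"])
      (auto simp: m_def abs_mult)
  then have "(\<lambda>n. \<integral>x. \<phi> x * (g x * ((exp (w n x) - 1) / h n)) \<partial>lborel)
      \<longlonglongrightarrow> (\<integral>x. \<phi> x * (g x * ((x \<bullet> u) / \<sigma>\<^sup>2)) \<partial>lborel)"
  proof (rule integral_dominated_convergence[rotated 2])
    show "AE x in lborel. (\<lambda>n. \<phi> x * (g x * ((exp (w n x) - 1) / h n)))
        \<longlonglongrightarrow> \<phi> x * (g x * ((x \<bullet> u) / \<sigma>\<^sup>2))"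
    proof (rule AE_I2)
      fix x
      have "((\<lambda>t. exp ((t * (x \<bullet> u) - t\<^sup>2 / 2) / \<sigma>\<^sup>2)) has_field_derivative (x \<bullet> u) / \<sigma>\<^sup>2) (at 0)"
        using \<sigma>_pos by (auto intro!: derivative_eq_intros simp: field_simps eval_nat_numeral)
      from filterlim_compose[OF this[unfolded DERIV_def] h_lim]
      show "(\<lambda>n. \<phi> x * (g x * ((exp (w n x) - 1) / h n))) \<longlonglongrightarrow> \<phi> x * (g x * ((x \<bullet> u) / \<sigma>\<^sup>2))"
        by (intro tendsto_mult_left) (simp add: w_def)
    qed
    show "AE x in lborel. norm (\<phi> x * (g x * ((exp (w n x) - 1) / h n)))
        \<le> \<phi> x * ((\<bar>g 0\<bar> + 1) * exp m * exp ((1 + m) * norm x))" for n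
    proof (rule AE_I2)
      fix x :: 'a
      define r where "r = (norm x + 1) / \<sigma>\<^sup>2"
      have r0: "0 \<le> r" by (simp add: r_def)
      have "\<bar>h n * (x \<bullet> u) - (h n)\<^sup>2 / 2\<bar> = h n * \<bar>x \<bullet> u - h n / 2\<bar>"
      proof -
        have "h n * (x \<bullet> u) - (h n)\<^sup>2 / 2 = h n * (x \<bullet> u - h n / 2)"
          by (simp add: algebra_simps power2_eq_square)
        then show ?thesis
          using h(1)[of n] by (simp only: abs_mult abs_of_pos)
      qed
      also have "\<dots> \<le> h n * (norm x + 1)"
      proof (rule mult_left_mono)
        have "\<bar>x \<bullet> u\<bar> \<le> norm x"
          using Cauchy_Schwarz_ineq2[of x u] u by simp
        then show "\<bar>x \<bullet> u - h n / 2\<bar> \<le> norm x + 1"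
          using h[of n] by arith
      qed (use h(1)[of n] in simp)
      finally have w: "\<bar>w n x\<bar> \<le> h n * r"
        using divide_right_mono[of _ "h n * (norm x + 1)" "\<sigma>\<^sup>2"] by (simp add: w_def r_def)
      also have "h n * r \<le> r"
        using h[of n] r0 by (simp add: mult_left_le_one_le)
      finally have w': "\<bar>w n x\<bar> \<le> r" .
      have "\<bar>exp (w n x) - 1\<bar> \<le> (h n * r) * exp r"
        using w w' r0 h[of n] by (intro order_trans[OF abs_exp_minus_1_le] mult_mono) auto
      also have "\<dots> \<le> h n * (exp r * exp r)"
        using h[of n] le_exp_self[of r] by (simp add: mult_right_mono)
      also have "exp r * exp r = exp (m + m * norm x)"
        by (simp add: r_def m_def algebra_simps add_divide_distrib flip: exp_add)
      finally have "\<bar>(exp (w n x) - 1) / h n\<bar> \<le> exp (m + m * norm x)"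
        using h[of n] by (simp add: divide_le_eq mult.commute)
      then have "\<bar>g x\<bar> * \<bar>(exp (w n x) - 1) / h n\<bar> \<le> ((\<bar>g 0\<bar> + 1) * exp (norm x)) * exp (m + m * norm x)"
        using g_growth[of x] by (intro mult_mono) auto
      also have "\<dots> = (\<bar>g 0\<bar> + 1) * exp m * exp ((1 + m) * norm x)"
        by (simp add: exp_add algebra_simps)
      finally have "\<phi> x * (\<bar>g x\<bar> * \<bar>(exp (w n x) - 1) / h n\<bar>)
          \<le> \<phi> x * ((\<bar>g 0\<bar> + 1) * exp m * exp ((1 + m) * norm x))"
        by (intro mult_left_mono density_nonneg)
      then show "norm (\<phi> x * (g x * ((exp (w n x) - 1) / h n)))
        \<le> \<phi> x * ((\<bar>g 0\<bar> + 1) * exp m * exp ((1 + m) * norm x))"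
        using density_nonneg[of x] by (simp add: abs_mult)
    qed
  qed (auto simp: w_def)
  then have "(\<integral>x. \<phi> x * D x \<partial>lborel) = (\<integral>x. \<phi> x * (g x * ((x \<bullet> u) / \<sigma>\<^sup>2)) \<partial>lborel)"
    using lim1' LIMSEQ_unique by (simp only: parts)
  then show "(\<integral>x. \<phi> x * D x \<partial>lborel) = (\<integral>x. \<phi> x * (g x * (x \<bullet> u)) \<partial>lborel) / \<sigma>\<^sup>2"
    by simp
qed

end

section \<open>Fused groups and the projection of a coordinate vector\<close>

text \<open>The linear forms of the penalty: the difference along an edge, for \<^const>\<open>Inl\<close>, and the value
  at a vertex, for \<^const>\<open>Inr\<close>.\<close>
definition flni_direction :: "('n \<times> 'n) + 'n \<Rightarrow> real ^ 'n::finite" where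
  "flni_direction = case_sum (\<lambda>(i, j). axis i 1 - axis j 1) (\<lambda>i. axis i 1)"

text \<open>\<open>N\<close> is the set of coordinates whose sign belongs to the pattern. A group without coordinates in \<open>N\<close>
  is free to move even if it is fitted as \<open>0\<close>.\<close>
definition flni_index :: "('n \<times> 'n) set \<Rightarrow> 'n set \<Rightarrow> (('n \<times> 'n) + 'n) set" where
  "flni_index E N = Inl ` E \<union> Inr ` N"

lemma flni_direction_inner [simp]:
  "flni_direction (Inl (i, j)) \<bullet> x = x $ i - x $ j"
  "flni_direction (Inr i) \<bullet> x = x $ i"
  by (simp_all add: flni_direction_def inner_diff_left inner_axis')

abbreviation same_group :: "('n \<times> 'n) set \<Rightarrow> real ^ 'n::finite \<Rightarrow> 'n rel" where
  "same_group E x \<equiv> (fused_edges E x \<union> (fused_edges E x)\<inverse>)\<^sup>*"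

lemma equiv_same_group: "equiv UNIV (same_group E x)"
  by (intro equivI refl_rtrancl trans_rtrancl sym_rtrancl) (auto simp: sym_Un_converse)

lemma sym_same_group: "sym (same_group E x)"
  by (intro sym_rtrancl) (simp add: sym_Un_converse)

lemma eq_on_same_group:
  assumes "\<And>i j. (i, j) \<in> fused_edges E x \<Longrightarrow> d i = d j"
    and "(i, j) \<in> same_group E x"
  shows "d i = d j"
  using assms(2) by induction (use assms(1) in auto)

text \<open>A group is pinned if it contains a coordinate of \<open>N\<close> that is fitted as \<open>0\<close>: directions that respect
  the sign pattern then vanish on the whole group.\<close>
definition unpinned :: "'n set \<Rightarrow> real ^ 'n \<Rightarrow> 'n set \<Rightarrow> bool" where
  "unpinned N x C \<longleftrightarrow> (\<forall>i\<in>C \<inter> N. x $ i \<noteq> 0)"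

definition unpinned_groups :: "('n \<times> 'n) set \<Rightarrow> 'n set \<Rightarrow> real ^ 'n::finite \<Rightarrow> 'n set set" where
  "unpinned_groups E N x = {C \<in> fused_groups E x. unpinned N x C}"

text \<open>The orthogonal projection of the coordinate vector \<open>axis i 1\<close> onto the vectors that are constant
  on groups and vanish on pinned groups, that is, the group averages of that vector.\<close>
definition axis_projection :: "('n \<times> 'n) set \<Rightarrow> 'n set \<Rightarrow> real ^ 'n \<Rightarrow> 'n::finite \<Rightarrow> real ^ 'n" where
  "axis_projection E N x i = (\<chi> j. if unpinned N x (same_group E x `` {i}) \<and> (i, j) \<in> same_group E x
     then 1 / card (same_group E x `` {i}) else 0)"

text \<open>The trace of the projection: each of the \<open>card C\<close> vertices of an unpinned group \<open>C\<close>
  contributes \<open>1 / card C\<close>.\<close>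
lemma sum_axis_projection:
  "(\<Sum>i\<in>UNIV. axis_projection E N x i $ i) = card (unpinned_groups E N x)"
proof -
  let ?r = "same_group E x"
  let ?w = "\<lambda>C. if unpinned N x C then 1 / card C else 0 :: real"
  have img: "(\<lambda>i. ?r `` {i}) ` UNIV = fused_groups E x"
    by (auto simp: fused_groups_def quotient_def)
  have fib: "{i \<in> UNIV. ?r `` {i} = C} = C" if C: "C \<in> fused_groups E x" for C
  proof -
    obtain k where k: "C = ?r `` {k}"
      using C by (auto simp: fused_groups_def elim: quotientE)
    show ?thesis
      unfolding k by (auto simp: eq_equiv_class_iff[OF equiv_same_group]
          dest: symD[OF sym_same_group])
  qed
  have "(\<Sum>i\<in>UNIV. axis_projection E N x i $ i) = (\<Sum>i\<in>UNIV. ?w (?r `` {i}))"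
    by (simp add: axis_projection_def)
  also have "\<dots> = (\<Sum>C\<in>fused_groups E x. \<Sum>i\<in>{i \<in> UNIV. ?r `` {i} = C}. ?w (?r `` {i}))"
    using sum.image_gen[of UNIV "\<lambda>i. ?w (?r `` {i})" "\<lambda>i. ?r `` {i}"] by (simp add: img)
  also have "\<dots> = (\<Sum>C\<in>fused_groups E x. if unpinned N x C then 1 else 0)"
  proof (intro sum.cong refl)
    fix C assume C: "C \<in> fused_groups E x"
    have "C \<noteq> {}"
      using C in_quotient_imp_non_empty[OF equiv_same_group] by (auto simp: fused_groups_def)
    moreover have "(\<Sum>i\<in>{i \<in> UNIV. ?r `` {i} = C}. ?w (?r `` {i})) = (\<Sum>i\<in>C. ?w C)"
      using fib[OF C] by (intro sum.cong) auto
    ultimately show "(\<Sum>i\<in>{i \<in> UNIV. ?r `` {i} = C}. ?w (?r `` {i})) = (if unpinned N x C then 1 else 0)"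
      by (simp add: card_gt_0_iff)
  qed
  also have "\<dots> = card (unpinned_groups E N x)"
    by (simp add: unpinned_groups_def sum.If_cases Int_def)
  finally show ?thesis .
qed

lemma axis_projection_orthogonal:
  assumes v: "\<And>i j. (i, j) \<in> fused_edges E x \<Longrightarrow> v $ i = v $ j"
    "\<And>i. i \<in> N \<Longrightarrow> x $ i = 0 \<Longrightarrow> v $ i = 0"
  shows "(axis i 1 - axis_projection E N x i) \<bullet> v = 0"
proof (cases "unpinned N x (same_group E x `` {i})")
  case True
  let ?C = "same_group E x `` {i}"
  have "axis_projection E N x i \<bullet> v = (\<Sum>j\<in>UNIV. if j \<in> ?C then v $ j / card ?C else 0)"
    using True unfolding axis_projection_def inner_vec_def by (intro sum.cong) auto
  also have "\<dots> = (\<Sum>j\<in>?C. v $ j / card ?C)"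
    by (rule sum.mono_neutral_cong_right) auto
  also have "\<dots> = (\<Sum>j\<in>?C. v $ i / card ?C)"
    using eq_on_same_group[of E x "($) v" i] v(1) by (intro sum.cong) auto
  also have "\<dots> = v $ i"
  proof -
    have "i \<in> ?C" by simp
    then have "card ?C \<noteq> 0" by (metis card_eq_0_iff empty_iff finite)
    then show ?thesis by simp
  qed
  finally show ?thesis
    by (simp add: inner_diff_left inner_axis')
next
  case False
  then obtain j where "(i, j) \<in> same_group E x" "j \<in> N" "x $ j = 0"
    by (auto simp: unpinned_def)
  then have "v $ i = 0"
    using eq_on_same_group[of E x "($) v" i j] v by simp
  moreover have "axis_projection E N x i = 0"
    using False by (simp add: axis_projection_def vec_eq_iff)
  ultimately show ?thesis
    by (simp add: inner_axis')
qed

lemma axis_projection_mem: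
  shows "(j, k) \<in> fused_edges E x \<Longrightarrow> axis_projection E N x i $ j = axis_projection E N x i $ k"
    and "j \<in> N \<Longrightarrow> x $ j = 0 \<Longrightarrow> axis_projection E N x i $ j = 0"
proof -
  assume "(j, k) \<in> fused_edges E x"
  then have "(i, j) \<in> same_group E x \<longleftrightarrow> (i, k) \<in> same_group E x"
    by (meson UnI1 UnI2 converseI rtrancl.rtrancl_into_rtrancl)
  then show "axis_projection E N x i $ j = axis_projection E N x i $ k"
    by (simp add: axis_projection_def)
next
  assume "j \<in> N" "x $ j = 0"
  then show "axis_projection E N x i $ j = 0"
    by (auto simp: axis_projection_def unpinned_def)
qed

section \<open>The fused lasso nearly-isotonic approximator as a polyhedral proximal map\<close>

text \<open>The rate at which the penalty grows when a linear form increases from \<open>0\<close>, and below the rate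
  when it decreases from \<open>0\<close>; the nearly-isotonic part charges the first direction only.\<close>
definition flni_up :: "real \<Rightarrow> real \<Rightarrow> real \<Rightarrow> ('n \<times> 'n) + 'n \<Rightarrow> real" where
  "flni_up lF lL lNI = case_sum (\<lambda>_. lF + lNI) (\<lambda>_. lL)"

definition flni_down :: "real \<Rightarrow> real \<Rightarrow> ('n \<times> 'n) + 'n \<Rightarrow> real" where
  "flni_down lF lL = case_sum (\<lambda>_. lF) (\<lambda>_. lL)"

text \<open>If \<open>lL = 0\<close>, the coordinates contribute nothing to the penalty, so any index set \<open>N\<close>
  represents the same objective. This is what allows the choice \<open>N = {}\<close> for the fused
  nearly-isotonic regression.\<close>
lemma FLNI_objective_eq_polyhedral:
  assumes "irrefl (E :: ('n::finite \<times> 'n) set)" and N: "N = UNIV \<or> lL = 0"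
  shows "FLNI_objective E y lF lL lNI x = 1/2 * (norm (y - x))\<^sup>2
    + polyhedral_penalty (flni_index E N) flni_direction (flni_up lF lL lNI) (flni_down lF lL) x"
proof -
  have inc: "incidence_mult x e = flni_direction (Inl e) \<bullet> x" if "e \<in> E" for e
    using that assms(1) by (cases e) (auto simp: irrefl_def intro!: incidence_mult_eq)
  have edge: "(lF + lNI) * max 0 r + lF * max 0 (- r) = lF * \<bar>r\<bar> + lNI * pos_part r" for r :: real
    by (auto simp: pos_part_eq_max max_def algebra_simps)
  have vertex: "lL * max 0 r + lL * max 0 (- r) = lL * \<bar>r\<bar>" for r :: real
    by (auto simp: max_def)
  have "polyhedral_penalty (flni_index E N) flni_direction (flni_up lF lL lNI) (flni_down lF lL) x
    = (\<Sum>e\<in>E. lF * \<bar>incidence_mult x e\<bar> + lNI * pos_part (incidence_mult x e)) + (\<Sum>i\<in>N. lL * \<bar>x $ i\<bar>)"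
    unfolding polyhedral_penalty_def flni_index_def
    by (subst sum.union_disjoint)
      (auto simp: sum.reindex flni_up_def flni_down_def edge vertex inc cong: sum.cong)
  also have "(\<Sum>i\<in>N. lL * \<bar>x $ i\<bar>) = lL * l1_norm_on UNIV (($) x)"
    using N by (auto simp: l1_norm_on_def sum_distrib_left)
  finally show ?thesis
    by (simp add: FLNI_objective_def l1_norm_on_def plus_norm_on_def sum.distrib sum_distrib_left)
qed

lemma FLNI_polyhedral_prox:
  assumes "irrefl (E :: ('n::finite \<times> 'n) set)" "N = UNIV \<or> lL = 0" "lF \<ge> 0" "lL \<ge> 0" "lNI \<ge> 0"
  shows "polyhedral_prox (flni_index E N) flni_direction (flni_up lF lL lNI) (flni_down lF lL)
    (\<lambda>y. FLNI E y lF lL lNI)"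
proof
  show "finite (flni_index E N)" by (simp add: flni_index_def)
  fix k :: "('n \<times> 'n) + 'n"
  show "0 \<le> flni_up lF lL lNI k"
    using assms(3-5) by (cases k) (auto simp: flni_up_def)
  show "0 \<le> flni_down lF lL k"
    using assms(3-5) by (cases k) (auto simp: flni_down_def)
next
  fix y x :: "real ^ 'n"
  have "is_arg_min (FLNI_objective E y lF lL lNI) (\<lambda>_. True) (FLNI E y lF lL lNI)"
    unfolding FLNI_def arg_min_def using FLNI_unique_minimizer[OF assms(3-5)] by (metis someI_ex)
  then have "FLNI_objective E y lF lL lNI (FLNI E y lF lL lNI) \<le> FLNI_objective E y lF lL lNI x"
    by (simp add: is_arg_min_linorder)
  then show "1/2 * (norm (y - FLNI E y lF lL lNI))\<^sup>2 + polyhedral_penalty (flni_index E N)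
      flni_direction (flni_up lF lL lNI) (flni_down lF lL) (FLNI E y lF lL lNI)
    \<le> 1/2 * (norm (y - x))\<^sup>2 + polyhedral_penalty (flni_index E N)
      flni_direction (flni_up lF lL lNI) (flni_down lF lL) x"
    by (simp only: FLNI_objective_eq_polyhedral[OF assms(1,2)])
qed

locale graph_prox = polyhedral_prox "flni_index E N" flni_direction p q f
  for E :: "('n::finite \<times> 'n) set" and N p q and f :: "real ^ 'n \<Rightarrow> real ^ 'n"
begin

lemma mem_face_space_iff:
  "d \<in> face_space x \<longleftrightarrow> (\<forall>i j. (i, j) \<in> fused_edges E x \<longrightarrow> d $ i = d $ j)
     \<and> (\<forall>i\<in>N. x $ i = 0 \<longrightarrow> d $ i = 0)"
proof -
  have "d \<in> face_space x \<longleftrightarrow>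
      (\<forall>e\<in>E. flni_direction (Inl e) \<bullet> x = 0 \<longrightarrow> flni_direction (Inl e) \<bullet> d = 0)
      \<and> (\<forall>i\<in>N. flni_direction (Inr i) \<bullet> x = 0 \<longrightarrow> flni_direction (Inr i) \<bullet> d = 0)"
    unfolding face_space_def mem_Collect_eq unfolding flni_index_def by blast
  moreover have "(flni_direction (Inl e) \<bullet> x = 0 \<longrightarrow> flni_direction (Inl e) \<bullet> d = 0)
      \<longleftrightarrow> (x $ fst e = x $ snd e \<longrightarrow> d $ fst e = d $ snd e)" for e
    by (cases e) simp
  ultimately have "d \<in> face_space x \<longleftrightarrow> (\<forall>e\<in>E. x $ fst e = x $ snd e \<longrightarrow> d $ fst e = d $ snd e)
      \<and> (\<forall>i\<in>N. x $ i = 0 \<longrightarrow> d $ i = 0)"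
    by simp
  then show ?thesis
    unfolding fused_edges_def by fastforce
qed

text \<open>What the projection depends on is a function of the sign pattern, hence measurable in \<open>y\<close>.\<close>
lemma sign_pattern_eqD:
  assumes "sign_pattern x = sign_pattern x'"
  shows "fused_edges E x = fused_edges E x'" and "unpinned N x = unpinned N x'"
proof -
  have k: "flni_direction k \<bullet> x = 0 \<longleftrightarrow> flni_direction k \<bullet> x' = 0" if "k \<in> flni_index E N" for k
    using assms that unfolding sign_pattern_eq_iff by (metis sgn_zero_iff)
  show "fused_edges E x = fused_edges E x'"
  proof -
    have "x $ i = x $ j \<longleftrightarrow> x' $ i = x' $ j" if "(i, j) \<in> E" for i j
      using k[of "Inl (i, j)"] that by (simp add: flni_index_def)
    then show ?thesis by (auto simp: fused_edges_def)
  qed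
  have "x $ i = 0 \<longleftrightarrow> x' $ i = 0" if "i \<in> N" for i
    using k[of "Inr i"] that by (simp add: flni_index_def)
  then show "unpinned N x = unpinned N x'"
    by (auto simp: unpinned_def fun_eq_iff)
qed

lemma axis_projection_measurable:
  "(\<lambda>y. axis_projection E N (f y) i $ i) \<in> borel_measurable borel"
proof (rule borel_measurable_pattern_function)
  fix x x' assume "sign_pattern x = sign_pattern x'"
  then have "axis_projection E N x i = axis_projection E N x' i"
    unfolding axis_projection_def by (simp only: sign_pattern_eqD[of x x'])
  then show "axis_projection E N x i $ i = axis_projection E N x' i $ i"
    by simp
qed

lemma AE_prox_deriv:
  "AE y in lborel. ((\<lambda>t. (f (y + t *\<^sub>R axis i 1) $ i - f y $ i) / t)
     \<longlongrightarrow> axis_projection E N (f y) i $ i) (at 0)"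
  using AE_interior_cell
proof eventually_elim
  case (elim y)
  let ?d = "axis_projection E N (f y) i"
  have "eventually (\<lambda>t. f (y + t *\<^sub>R axis i 1) = f y + t *\<^sub>R ?d) (at 0)"
    using elim
  proof (rule eventually_prox_line)
    show "?d \<in> face_space (f y)"
      using axis_projection_mem[where E = E and N = N and x = "f y"] by (auto simp: mem_face_space_iff)
    show "(axis i 1 - ?d) \<bullet> v = 0" if "v \<in> face_space (f y)" for v
      using that by (intro axis_projection_orthogonal) (auto simp: mem_face_space_iff)
  qed
  then have "eventually (\<lambda>t. (f (y + t *\<^sub>R axis i 1) $ i - f y $ i) / t = ?d $ i) (at 0)"
    using eventually_neq_at_within[of 0] by eventually_elim simp
  then show ?case
    by (rule tendsto_eventually)
qed

end

section \<open>Expected number of groups and degrees of freedom\<close>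

lemma covariance_cong:
  assumes "\<And>\<omega>. \<omega> \<in> space M \<Longrightarrow> X \<omega> = X' \<omega>" "\<And>\<omega>. \<omega> \<in> space M \<Longrightarrow> Z \<omega> = Z' \<omega>"
  shows "covariance M X Z = covariance M X' Z'"
proof -
  have "integral\<^sup>L M X = integral\<^sup>L M X'" "integral\<^sup>L M Z = integral\<^sup>L M Z'"
    by (intro Bochner_Integration.integral_cong refl assms; assumption)+
  then show ?thesis
    unfolding covariance_def by (intro Bochner_Integration.integral_cong refl) (simp add: assms)
qed

lemma multivariate_normal_density_eq_exp:
  assumes "\<sigma> > 0"
  shows "multivariate_normal_density 0 (mat (\<sigma>\<^sup>2)) (x :: real ^ 'n::finite)
    = (1 / sqrt (2 * pi * \<sigma>\<^sup>2)) ^ CARD('n) * exp (- (norm x)\<^sup>2 / (2 * \<sigma>\<^sup>2))"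
proof -
  have "(norm x)\<^sup>2 = (\<Sum>i\<in>UNIV. (x $ i)\<^sup>2)"
    unfolding power2_norm_eq_inner inner_vec_def by (simp add: power2_eq_square)
  then have "- (norm x)\<^sup>2 / (2 * \<sigma>\<^sup>2) = (\<Sum>i\<in>UNIV. - (x $ i)\<^sup>2 / (2 * \<sigma>\<^sup>2))"
    by (simp add: sum_negf sum_divide_distrib)
  then show ?thesis
    unfolding multivariate_normal_density_isotropic[OF assms] normal_density_def
    by (simp only: exp_sum[OF finite] prod.distrib diff_0_right prod_constant)
qed

text \<open>Stein's identity, applied to each coordinate of the fit as a function of the noise, gives the
  covariance of the coordinate with the noise as the expected diagonal entry of the projection;
  the sum of these entries counts the unpinned groups pointwise. The identity for a constant function
  says that the noise is centred.\<close>
theorem (in graph_prox) expected_unpinned_groups_eq_df: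
  fixes \<beta>0 :: "real ^ 'n" and \<epsilon> Y :: "'w \<Rightarrow> real ^ 'n"
  assumes M: "prob_space M" and \<sigma>: "\<sigma> > 0"
    and dist: "distributed M lborel \<epsilon> (\<lambda>x. ennreal (multivariate_normal_density 0 (mat (\<sigma>\<^sup>2)) x))"
    and Y: "\<And>\<omega>. \<omega> \<in> space M \<Longrightarrow> Y \<omega> = \<beta>0 + \<epsilon> \<omega>"
  shows "integrable M (\<lambda>\<omega>. real (card (unpinned_groups E N (f (Y \<omega>)))))"
    and "df_exists M (\<lambda>\<omega>. f (Y \<omega>)) Y"
    and "(\<integral>\<omega>. real (card (unpinned_groups E N (f (Y \<omega>)))) \<partial>M) = df M \<sigma> (\<lambda>\<omega>. f (Y \<omega>)) Y"
proof -
  interpret M: prob_space M by (rule M)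
  define \<phi> where "\<phi> = (multivariate_normal_density 0 (mat (\<sigma>\<^sup>2)) :: real ^ 'n \<Rightarrow> real)"
  have \<phi>_eq: "\<phi> x = (1 / sqrt (2 * pi * \<sigma>\<^sup>2)) ^ CARD('n) * exp (- (norm x)\<^sup>2 / (2 * \<sigma>\<^sup>2))" for x
    using multivariate_normal_density_eq_exp[OF \<sigma>] by (simp add: \<phi>_def)
  then have \<phi>_nonneg: "0 \<le> \<phi> x" for x by simp
  have dist': "distributed M lborel \<epsilon> (\<lambda>x. ennreal (\<phi> x))"
    using dist by (simp add: \<phi>_def)
  have E_eq: "(\<integral>\<omega>. F (\<epsilon> \<omega>) \<partial>M) = (\<integral>x. \<phi> x * F x \<partial>lborel)"
    and E_int: "integrable M (\<lambda>\<omega>. F (\<epsilon> \<omega>)) \<longleftrightarrow> integrable lborel (\<lambda>x. \<phi> x * F x)"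
    if "F \<in> borel_measurable borel" for F :: "real ^ 'n \<Rightarrow> real"
    using distributed_integral[OF dist', of F] distributed_integrable[OF dist', of F] that \<phi>_nonneg
    by simp_all
  interpret isotropic_gaussian \<phi> "(1 / sqrt (2 * pi * \<sigma>\<^sup>2)) ^ CARD('n)" \<sigma>
  proof
    show "integrable lborel \<phi>"
      using E_int[of "\<lambda>_. 1"] by simp
  qed (use \<sigma> \<phi>_eq in auto)

  define g where "g i x = f (\<beta>0 + x) $ i" for i x
  define D where "D i x = axis_projection E N (f (\<beta>0 + x)) i $ i" for i x
  have u: "norm (axis i 1 :: real ^ 'n) = 1" for i
    by simp
  have u_inner: "x \<bullet> axis i 1 = x $ i" for x :: "real ^ 'n" and i
    by (simp add: inner_axis)
  have lip: "\<bar>g i x - g i y\<bar> \<le> norm (x - y)" for i x y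
  proof -
    have "\<bar>g i x - g i y\<bar> \<le> norm (f (\<beta>0 + x) - f (\<beta>0 + y))"
      using component_le_norm_cart[of "f (\<beta>0 + x) - f (\<beta>0 + y)" i] by (simp add: g_def)
    also have "\<dots> \<le> norm (x - y)"
      using prox_nonexpansive[of "\<beta>0 + x" "\<beta>0 + y"] by simp
    finally show ?thesis .
  qed
  have D_meas [measurable]: "D i \<in> borel_measurable borel" for i
    unfolding D_def by (rule measurable_compose[OF _ axis_projection_measurable]) simp
  have g_meas [measurable]: "g i \<in> borel_measurable borel" for i
    by (rule lipschitz_borel_measurable[OF lip])
  have deriv: "AE x in lborel. ((\<lambda>t. (g i (x + t *\<^sub>R axis i 1) - g i x) / t) \<longlongrightarrow> D i x) (at 0)" for i
  proof -
    have "AE y in distr lborel borel ((+) \<beta>0). ((\<lambda>t. (f (y + t *\<^sub>R axis i 1) $ i - f y $ i) / t)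
        \<longlongrightarrow> axis_projection E N (f y) i $ i) (at 0)"
      unfolding lborel_distr_plus by (rule AE_prox_deriv)
    from AE_distrD[OF _ this] show ?thesis
      by (simp add: g_def D_def add.assoc)
  qed
  have stein: "(\<integral>\<omega>. D i (\<epsilon> \<omega>) \<partial>M) = (\<integral>\<omega>. g i (\<epsilon> \<omega>) * \<epsilon> \<omega> $ i \<partial>M) / \<sigma>\<^sup>2" for i
    using stein_identity(1)[OF u lip D_meas deriv, of i] E_eq[OF D_meas] E_eq[of "\<lambda>x. g i x * x $ i"]
    by (simp add: u_inner)
  have D_int: "integrable M (\<lambda>\<omega>. D i (\<epsilon> \<omega>))" for i
    using stein_identity(2)[OF u lip D_meas deriv, of i] E_int[OF D_meas] by simp
  have g_int: "integrable M (\<lambda>\<omega>. g i (\<epsilon> \<omega>))" for i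
    using integrable_lipschitz[OF lip, of i] E_int[OF g_meas] by simp
  have g\<epsilon>_int: "integrable M (\<lambda>\<omega>. g i (\<epsilon> \<omega>) * \<epsilon> \<omega> $ i)" for i
    using integrable_lipschitz_mult_inner[OF lip u, of i i] E_int[of "\<lambda>x. g i x * x $ i"]
    by (simp add: u_inner)
  have \<epsilon>_int: "integrable M (\<lambda>\<omega>. \<epsilon> \<omega> $ i)" for i
    using integrable_lipschitz_mult_inner[of "\<lambda>_. 1" "axis i 1"] E_int[of "\<lambda>x. x $ i"]
    by (simp add: u_inner)
  have mean: "(\<integral>\<omega>. \<epsilon> \<omega> $ i \<partial>M) = 0" for i
    using stein_identity(1)[of "axis i 1" "\<lambda>_. 1" "\<lambda>_. 0"] \<sigma> E_eq[of "\<lambda>x. x $ i"]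
    by (simp add: u_inner)

  have K: "real (card (unpinned_groups E N (f (Y \<omega>)))) = (\<Sum>i\<in>UNIV. D i (\<epsilon> \<omega>))"
    if "\<omega> \<in> space M" for \<omega>
    unfolding D_def Y[OF that] by (rule sum_axis_projection[symmetric])
  have cov: "covariance M (\<lambda>\<omega>. f (Y \<omega>) $ i) (\<lambda>\<omega>. Y \<omega> $ i) = (\<integral>\<omega>. g i (\<epsilon> \<omega>) * \<epsilon> \<omega> $ i \<partial>M)" for i
  proof -
    have "covariance M (\<lambda>\<omega>. f (Y \<omega>) $ i) (\<lambda>\<omega>. Y \<omega> $ i)
        = covariance M (\<lambda>\<omega>. g i (\<epsilon> \<omega>)) (\<lambda>\<omega>. \<beta>0 $ i + \<epsilon> \<omega> $ i)"
      by (intro covariance_cong) (simp_all add: Y g_def)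
    also have "\<dots> = (\<integral>\<omega>. g i (\<epsilon> \<omega>) * \<epsilon> \<omega> $ i - (\<integral>\<omega>. g i (\<epsilon> \<omega>) \<partial>M) * \<epsilon> \<omega> $ i \<partial>M)"
      using \<epsilon>_int by (simp add: covariance_def mean M.prob_space left_diff_distrib)
    also have "\<dots> = (\<integral>\<omega>. g i (\<epsilon> \<omega>) * \<epsilon> \<omega> $ i \<partial>M)"
      using g\<epsilon>_int \<epsilon>_int by (simp add: mean)
    finally show ?thesis .
  qed
  show "integrable M (\<lambda>\<omega>. real (card (unpinned_groups E N (f (Y \<omega>)))))"
    using D_int by (subst Bochner_Integration.integrable_cong[OF refl K]) auto
  have "(\<integral>\<omega>. real (card (unpinned_groups E N (f (Y \<omega>)))) \<partial>M) = (\<Sum>i\<in>UNIV. \<integral>\<omega>. D i (\<epsilon> \<omega>) \<partial>M)"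
    using D_int by (subst Bochner_Integration.integral_cong[OF refl K]) auto
  then show "(\<integral>\<omega>. real (card (unpinned_groups E N (f (Y \<omega>)))) \<partial>M) = df M \<sigma> (\<lambda>\<omega>. f (Y \<omega>)) Y"
    by (simp add: df_def stein cov sum_divide_distrib)
  show "df_exists M (\<lambda>\<omega>. f (Y \<omega>)) Y"
    unfolding df_exists_def covariance_exists_def
  proof (intro allI conjI)
    fix i
    have fY: "f (Y \<omega>) $ i = g i (\<epsilon> \<omega>)" and Y_i: "Y \<omega> $ i = \<beta>0 $ i + \<epsilon> \<omega> $ i"
      if "\<omega> \<in> space M" for \<omega>
      by (simp_all add: Y[OF that] g_def)
    have *: "integrable M (\<lambda>\<omega>. g i (\<epsilon> \<omega>))" "integrable M (\<lambda>\<omega>. \<beta>0 $ i + \<epsilon> \<omega> $ i)"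
      "integrable M (\<lambda>\<omega>. g i (\<epsilon> \<omega>) * (\<beta>0 $ i + \<epsilon> \<omega> $ i))"
      using g_int \<epsilon>_int g\<epsilon>_int by (auto simp: distrib_left)
    show "integrable M (\<lambda>\<omega>. f (Y \<omega>) $ i)" "integrable M (\<lambda>\<omega>. Y \<omega> $ i)"
      "integrable M (\<lambda>\<omega>. f (Y \<omega>) $ i * Y \<omega> $ i)"
      using * by (simp_all cong: Bochner_Integration.integrable_cong add: fY Y_i)
  qed
qed

theorem theorem3:
  fixes R :: "'n::finite rel"
    and E :: "('n \<times> 'n) set"
    and M :: "'w measure"
    and \<beta>0 :: "real ^ 'n"
    and \<epsilon> Y :: "'w \<Rightarrow> real ^ 'n"
    and \<sigma> lF lL lNI :: real
  assumes "partial_order_on UNIV R"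
    and "corresponds E R"
    and "prob_space M"
    and "\<sigma> > 0"
    and "distributed M lborel \<epsilon> (\<lambda>x. ennreal (multivariate_normal_density 0 (mat (\<sigma>\<^sup>2)) x))"
    and "\<And>\<omega>. \<omega> \<in> space M \<Longrightarrow> Y \<omega> = \<beta>0 + \<epsilon> \<omega>"
    and "lF \<ge> 0" and "lL \<ge> 0" and "lNI \<ge> 0"
  shows "(integrable M (\<lambda>\<omega>. real (K_FNI E (Y \<omega>) lF lNI))
        \<and> df_exists M (\<lambda>\<omega>. FNI E (Y \<omega>) lF lNI) Y
        \<and> (\<integral>\<omega>. real (K_FNI E (Y \<omega>) lF lNI) \<partial>M)
            = df M \<sigma> (\<lambda>\<omega>. FNI E (Y \<omega>) lF lNI) Y)
     \<and> (integrable M (\<lambda>\<omega>. real (K_FLNI E (Y \<omega>) lF lL lNI))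
        \<and> df_exists M (\<lambda>\<omega>. FLNI E (Y \<omega>) lF lL lNI) Y
        \<and> (\<integral>\<omega>. real (K_FLNI E (Y \<omega>) lF lL lNI) \<partial>M)
            = df M \<sigma> (\<lambda>\<omega>. FLNI E (Y \<omega>) lF lL lNI) Y)"
proof -
  have irrefl: "irrefl E"
    using assms(2) by (simp add: corresponds_def)
  interpret FNI: graph_prox E "{}" "flni_up lF 0 lNI" "flni_down lF 0" "\<lambda>y. FLNI E y lF 0 lNI"
    unfolding graph_prox_def using irrefl assms by (intro FLNI_polyhedral_prox) auto
  interpret FLNI: graph_prox E UNIV "flni_up lF lL lNI" "flni_down lF lL" "\<lambda>y. FLNI E y lF lL lNI"
    unfolding graph_prox_def using irrefl assms by (intro FLNI_polyhedral_prox) auto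
  have K_FNI: "K_FNI E y lF lNI = card (unpinned_groups E {} (FLNI E y lF 0 lNI))" for y
    by (simp add: K_FNI_def FNI_def unpinned_groups_def unpinned_def)
  have K_FLNI: "K_FLNI E y lF lL lNI = card (unpinned_groups E UNIV (FLNI E y lF lL lNI))" for y
    by (simp add: K_FLNI_def nonzero_fused_groups_def unpinned_groups_def unpinned_def)
  show ?thesis
    unfolding K_FNI K_FLNI FNI_def
    using FNI.expected_unpinned_groups_eq_df[OF assms(3-6)]
      FLNI.expected_unpinned_groups_eq_df[OF assms(3-6)]
    by blast
qed

end
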